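(* Let $a,b\in\mathbb{R}$ with $b\neq0$ and $-a<b<a$, and put $\mu=\sqrt{a-b}$, $\nu=\sqrt{a+b}$. Let $g\in AP(\mathbb{R})$, and suppose there are constants $\rho>0$ and $\sigma>0$ such that for all $\lambda_k\in\mathrm{Freq}(g)$ one has $|\mu\pm\lambda_k|\ge\rho$ and $|\nu\pm\lambda_k|\ge\sigma$. Then: (1) every solution of $$\ddot x(t)+a x(t)+b x(-t)=g(t),\qquad t\in\mathbb{R},$$ is almost periodic; (2) there exists a unique almost periodic solution $x(t)$ of this equation satisfying the initial conditions $x(0)=x_0$, $\dot x(0)=\dot x_0$ (for given initial values $x_0,\dot x_0$).
   Context: A solution is a twice differentiable function $x:\mathbb{R}\to\mathbb{C}$ satisfying the equation for all $t\in\mathbb{R}$. A (continuous) function $f:\mathbb{R}\to\mathbb{C}$ is almost periodic if for every $\epsilon>0$ the set $\{\tau\in\mathbb{R}: |f(t+\tau)-f(t)|<\epsilon \ \forall t\in\mathbb{R}\}$ is relatively dense in $\mathbb{R}$; $AP(\mathbb{R})$ denotes the set of all such functions. $\mathrm{Freq}(f)$ denotes the frequency set of $f\in AP(\mathbb{R})$, i.e. the set of $\lambda\in\mathbb{R}$ with $\lim_{T\to\infty}\frac1{2T}\int_{-T}^{T}f(t)e^{-i\lambda t}dt\neq 0$. *)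

theory Defs
  imports "HOL-Analysis.Analysis"
begin

definition relatively_dense :: "real set \<Rightarrow> bool" where
  "relatively_dense S \<longleftrightarrow> (\<exists>l>0. \<forall>u. S \<inter> {u..u + l} \<noteq> {})"

definition almost_periodic :: "(real \<Rightarrow> complex) \<Rightarrow> bool" where
  "almost_periodic f \<longleftrightarrow>
     continuous_on UNIV f \<and>
     (\<forall>\<epsilon>>0. relatively_dense {\<tau>. \<forall>t. norm (f (t + \<tau>) - f t) < \<epsilon>})"

text \<open>The limit is required to exist and be nonzero; for almost periodic \<open>f\<close> it always exists.\<close>

definition Freq :: "(real \<Rightarrow> complex) \<Rightarrow> real set" where
  "Freq f = {\<omega>. \<exists>c. c \<noteq> 0 \<and>
     ((\<lambda>T. 1 / (2 * of_real T) * integral {-T..T} (\<lambda>t. f t * exp (- (\<i> * of_real \<omega> * of_real t))))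
        \<longlongrightarrow> c) at_top}"

definition derivative1 :: "(real \<Rightarrow> complex) \<Rightarrow> real \<Rightarrow> complex" where
  "derivative1 x t = vector_derivative x (at t)"

definition is_solution ::
    "real \<Rightarrow> real \<Rightarrow> (real \<Rightarrow> complex) \<Rightarrow> (real \<Rightarrow> complex) \<Rightarrow> bool" where
  "is_solution a b g x \<longleftrightarrow>
     (\<forall>t. x differentiable (at t)) \<and>
     (\<forall>t. derivative1 x differentiable (at t)) \<and>
     (\<forall>t. derivative1 (derivative1 x) t + of_real a * x t + of_real b * x (- t) = g t)"

end

theory Submission
  imports Defs
begin

text \<open>
  The reflection t -> -t splits the equation into two ordinary oscillators. If p and q are the even
  and the odd part of a solution, then p'' + \<nu>^2 p is the even part of g and q'' + \<mu>^2 q is the odd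
  part of g. An oscillator y'' + w^2 y = h is integrated once by the substitution
  P = exp(-iwt) (y' + iwy), for which P' = exp(-iwt) h, and y is recovered from P and from its
  counterpart for -w (lemma \<open>oscillator_almost_periodic\<close>). The assumption on the frequencies of g
  says that exp(-iwt) h has no frequency in a neighbourhood of 0, for w = \<nu>, -\<nu> with h the even part of g
  and for w = \<mu>, -\<mu> with h the odd part. So everything rests on one fact, \<open>almost_periodic_primitive\<close>: a primitive F of an almost periodic f is almost
  periodic if f has no frequencies near 0. Existence and uniqueness for the initial value problem
  are inherited from the two oscillators: the value x(0) belongs to p and the value x'(0) to q.

  The primitive is controlled by an inequality of Bohr and Favard (lemma \<open>spectral_gap_bound\<close>): if z
  is almost periodic, has no frequency in (-\<delta>, \<delta>) and is Lipschitz with constant M, then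
  |z| \<le> B M where B depends on \<delta> only. It is applied to z(t) = F(t + \<tau>) - F(t), where \<tau> is an
  \<epsilon>-almost period of f. Then z inherits the gap, z' is smaller than \<epsilon>, and hence |z| \<le> B \<epsilon>: the
  number \<tau> is an almost period of F.

  For the inequality let T be large such that 2 T is an almost period of z, and let u be the
  convolution, on the circle of length 2 T, of the restriction of z to [-T, T] with a positive kernel
  of mean 1 that is a trigonometric polynomial with frequencies in [-\<delta>/2, \<delta>/2]. The Fejer-Korovkin
  kernel has width of order 1/\<delta>, so |z(0) - u(0)| \<le> B M (lemma \<open>fk_mean_approx\<close>). It remains to see
  that u(0) tends to 0. The Fourier coefficients u_m of u are at most \<kappa> in modulus, where \<kappa> tends to
  0 as T grows, because the mean values of z at these frequencies vanish, and they do so uniformly on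
  compact sets of frequencies (lemma \<open>spectral_gap_uniform\<close>). A bound for each coefficient alone does
  not make u small, as there are about \<delta> T of them. This is where almost periodicity enters, through
  de la Vallee Poussin's argument for the uniqueness theorem. The autocorrelation U of u has Fourier
  coefficients |u_m|^2, and by Parseval the mean of |U|^2 is the sum of |u_m|^4, at most \<kappa>^2 times
  the sum of |u_m|^2, which is bounded. On the other hand the almost periods of z in [0, T]
  are almost periods of u and of U, up to constant factors in the error. If |u(0)| \<ge> c > 0, then |u| \<ge> c/2 on a set whose density is
  positive independently of T; thus U(0), which is the mean of |u|^2, is bounded below, and in the
  same way so is the mean of |U|^2. For small \<kappa> this is a contradiction
  (lemma \<open>fk_mean_variation_bound\<close>).
\<close>

section \<open>Almost periodic functions\<close>

definition almost_periods :: "(real \<Rightarrow> complex) \<Rightarrow> real \<Rightarrow> real set" where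
  "almost_periods f \<epsilon> = {\<tau>. \<forall>t. norm (f (t + \<tau>) - f t) < \<epsilon>}"

lemma almost_periodsI: "(\<And>t. norm (f (t + \<tau>) - f t) < \<epsilon>) \<Longrightarrow> \<tau> \<in> almost_periods f \<epsilon>"
  by (simp add: almost_periods_def)

lemma almost_periodsD: "\<tau> \<in> almost_periods f \<epsilon> \<Longrightarrow> norm (f (t + \<tau>) - f t) < \<epsilon>"
  by (simp add: almost_periods_def)

lemma almost_periodic_iff:
  "almost_periodic f \<longleftrightarrow>
     continuous_on UNIV f \<and> (\<forall>\<epsilon>>0. relatively_dense (almost_periods f \<epsilon>))"
  unfolding almost_periodic_def almost_periods_def ..

lemma almost_periodicD_cont: "almost_periodic f \<Longrightarrow> continuous_on UNIV f"
  by (simp add: almost_periodic_def)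

lemma almost_periods_mono: "\<tau> \<in> almost_periods f \<epsilon> \<Longrightarrow> \<epsilon> \<le> \<epsilon>' \<Longrightarrow> \<tau> \<in> almost_periods f \<epsilon>'"
  by (auto simp: almost_periods_def intro: less_le_trans)

lemma almost_period_in_interval:
  assumes "almost_periodic f" "\<epsilon> > 0"
  shows "\<exists>l>0. \<forall>u. \<exists>\<tau>\<in>almost_periods f \<epsilon>. u \<le> \<tau> \<and> \<tau> \<le> u + l"
proof -
  have "relatively_dense (almost_periods f \<epsilon>)"
    using assms by (simp add: almost_periodic_iff)
  then obtain l where l: "l > 0" "\<forall>u. almost_periods f \<epsilon> \<inter> {u..u + l} \<noteq> {}"
    unfolding relatively_dense_def by (elim exE conjE)
  have "\<exists>\<tau>\<in>almost_periods f \<epsilon>. u \<le> \<tau> \<and> \<tau> \<le> u + l" for u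
  proof -
    have "almost_periods f \<epsilon> \<inter> {u..u + l} \<noteq> {}" using l(2) by (rule spec)
    then show ?thesis by auto
  qed
  then show ?thesis using l(1) by blast
qed

lemma almost_period_diff:
  assumes "\<tau> \<in> almost_periods f \<epsilon>" "\<tau>' \<in> almost_periods f \<epsilon>'"
  shows "\<tau> - \<tau>' \<in> almost_periods f (\<epsilon> + \<epsilon>')"
proof -
  have "norm (f (t + (\<tau> - \<tau>')) - f t) < \<epsilon> + \<epsilon>'" for t
  proof -
    have "norm (f (t - \<tau>' + \<tau>) - f (t - \<tau>')) < \<epsilon>" using assms(1) by (rule almost_periodsD)
    moreover have "norm (f (t - \<tau>' + \<tau>') - f (t - \<tau>')) < \<epsilon>'" using assms(2) by (rule almost_periodsD)
    moreover have eq: "f (t + (\<tau> - \<tau>')) - f t = (f (t - \<tau>' + \<tau>) - f (t - \<tau>')) - (f (t - \<tau>' + \<tau>') - f (t - \<tau>'))"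
      by (simp add: algebra_simps)
    have "norm (f (t + (\<tau> - \<tau>')) - f t) \<le> norm (f (t - \<tau>' + \<tau>) - f (t - \<tau>')) + norm (f (t - \<tau>' + \<tau>') - f (t - \<tau>'))"
      unfolding eq by (rule norm_triangle_ineq4)
    ultimately show ?thesis by linarith
  qed
  then show ?thesis by (rule almost_periodsI)
qed

lemma almost_period_uminus:
  assumes "\<tau> \<in> almost_periods f \<epsilon>"
  shows "- \<tau> \<in> almost_periods f \<epsilon>"
proof -
  have "norm (f (t + - \<tau>) - f t) < \<epsilon>" for t
  proof -
    have "norm (f (t - \<tau> + \<tau>) - f (t - \<tau>)) < \<epsilon>" using assms by (rule almost_periodsD)
    then show ?thesis by (simp add: norm_minus_commute)
  qed
  then show ?thesis by (rule almost_periodsI)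
qed

lemma almost_periodic_bounded:
  assumes "almost_periodic f"
  shows "\<exists>C>0. \<forall>t. norm (f t) \<le> C"
proof -
  obtain l where l: "l > 0" "\<forall>u. \<exists>\<tau>\<in>almost_periods f 1. u \<le> \<tau> \<and> \<tau> \<le> u + l"
    using almost_period_in_interval[OF assms zero_less_one] by blast
  have "compact (f ` {0..l})"
    using almost_periodicD_cont[OF assms]
    by (intro compact_continuous_image) (auto intro: continuous_on_subset)
  then obtain B where B: "\<And>s. s \<in> {0..l} \<Longrightarrow> norm (f s) \<le> B"
    using compact_imp_bounded[of "f ` {0..l}"] unfolding bounded_iff by blast
  have "norm (f t) \<le> \<bar>B\<bar> + 1" for t
  proof -
    obtain \<tau> where \<tau>: "\<tau> \<in> almost_periods f 1" "- t \<le> \<tau>" "\<tau> \<le> - t + l" using l(2) by blast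
    have "norm (f (t + \<tau>) - f t) < 1" using \<tau>(1) by (rule almost_periodsD)
    moreover have "norm (f (t + \<tau>)) \<le> B" using \<tau> by (intro B) auto
    ultimately show ?thesis
      using norm_triangle_sub[of "f t" "f (t + \<tau>)"] norm_minus_commute[of "f t" "f (t + \<tau>)"] by linarith
  qed
  then show ?thesis by (intro exI[of _ "\<bar>B\<bar> + 1"]) auto
qed

lemma almost_periodic_uniformly_continuous:
  assumes "almost_periodic f" "\<epsilon> > 0"
  shows "\<exists>d>0. \<forall>s t. \<bar>s - t\<bar> < d \<longrightarrow> norm (f s - f t) < \<epsilon>"
proof -
  have e3: "\<epsilon>/3 > 0" using assms(2) by simp
  obtain l where l: "l > 0" "\<forall>u. \<exists>\<tau>\<in>almost_periods f (\<epsilon>/3). u \<le> \<tau> \<and> \<tau> \<le> u + l"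
    using almost_period_in_interval[OF assms(1) e3] by blast
  have "uniformly_continuous_on {-1..l+1} f"
    using almost_periodicD_cont[OF assms(1)]
    by (intro compact_uniformly_continuous) (auto intro: continuous_on_subset)
  then have "\<exists>d>0. \<forall>t\<in>{-1..l+1}. \<forall>s\<in>{-1..l+1}. dist s t < d \<longrightarrow> dist (f s) (f t) < \<epsilon>/3"
    unfolding uniformly_continuous_on_def using e3 by blast
  then obtain d where d: "d > 0" "\<And>s t. s \<in> {-1..l+1} \<Longrightarrow> t \<in> {-1..l+1} \<Longrightarrow> dist s t < d \<Longrightarrow> dist (f s) (f t) < \<epsilon>/3"
    by blast
  have "norm (f s - f t) < \<epsilon>" if st: "\<bar>s - t\<bar> < min d 1" for s t
  proof -
    obtain \<tau> where \<tau>: "\<tau> \<in> almost_periods f (\<epsilon>/3)" "- t \<le> \<tau>" "\<tau> \<le> - t + l" using l(2) by blast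
    have 1: "norm (f (t + \<tau>) - f t) < \<epsilon>/3" "norm (f (s + \<tau>) - f s) < \<epsilon>/3" using \<tau>(1) by (auto dest: almost_periodsD)
    have "dist (f (s + \<tau>)) (f (t + \<tau>)) < \<epsilon>/3"
      using \<tau> st by (intro d) (auto simp: dist_real_def)
    then have 2: "norm (f (s + \<tau>) - f (t + \<tau>)) < \<epsilon>/3" by (simp add: dist_norm)
    have eq: "f s - f t = (f (s + \<tau>) - f (t + \<tau>)) - (f (s + \<tau>) - f s) + (f (t + \<tau>) - f t)" by simp
    have "norm (f s - f t) \<le> norm (f (s + \<tau>) - f (t + \<tau>)) + norm (f (s + \<tau>) - f s) + norm (f (t + \<tau>) - f t)"
      unfolding eq by (intro norm_triangle_le add_right_mono norm_triangle_ineq4)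
    then show ?thesis using 1 2 by linarith
  qed
  then show ?thesis using d(1) by (intro exI[of _ "min d 1"]) auto
qed

text \<open>
By uniform continuity the \<epsilon>-almost periods contain intervals of a fixed length \<eta> with bounded gaps.
So they have positive lower density, which makes lower bounds for integrals over long windows possible.
\<close>

lemma almost_periods_contain_intervals:
  assumes z: "almost_periodic z" and e: "\<epsilon> > 0"
  shows "\<exists>L>0. \<exists>\<eta>>0. \<forall>s. \<exists>\<tau>. s \<le> \<tau> \<and> \<tau> + \<eta> \<le> s + L \<and> {\<tau>..\<tau>+\<eta>} \<subseteq> almost_periods z \<epsilon>"
proof -
  have e2: "\<epsilon>/2 > 0" using e by simp
  obtain l where l: "l > 0" "\<forall>u. \<exists>\<tau>\<in>almost_periods z (\<epsilon>/2). u \<le> \<tau> \<and> \<tau> \<le> u + l"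
    using almost_period_in_interval[OF z e2] by blast
  obtain d where d: "d > 0" "\<forall>s t. \<bar>s - t\<bar> < d \<longrightarrow> norm (z s - z t) < \<epsilon>/2"
    using almost_periodic_uniformly_continuous[OF z e2] by blast
  have "\<exists>\<tau>. s \<le> \<tau> \<and> \<tau> + d/2 \<le> s + (l + d/2) \<and> {\<tau>..\<tau>+d/2} \<subseteq> almost_periods z \<epsilon>" for s
  proof -
    obtain \<tau> where \<tau>: "\<tau> \<in> almost_periods z (\<epsilon>/2)" "s \<le> \<tau>" "\<tau> \<le> s + l" using l(2) by blast
    have "x \<in> almost_periods z \<epsilon>" if x: "x \<in> {\<tau>..\<tau>+d/2}" for x
    proof (rule almost_periodsI)
      fix t
      have "\<bar>(t + x) - (t + \<tau>)\<bar> < d" using x d(1) by auto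
      then have "norm (z (t + x) - z (t + \<tau>)) < \<epsilon>/2" using d(2) by blast
      then show "norm (z (t + x) - z t) < \<epsilon>"
        using norm_diff_triangle_less[OF _ almost_periodsD[OF \<tau>(1), of t]] by fastforce
    qed
    then show ?thesis using \<tau> by auto
  qed
  then show ?thesis using l(1) d(1) by (intro exI[of _ "l + d/2"] exI[of _ "d/2"] conjI) auto
qed

text \<open>
Sums and products of almost periodic functions are almost periodic because two such functions share
almost periods. In every interval of a fixed length choose an almost period p of f and an almost
period q of g. The differences p - q stay in a bounded interval, so up to an error d they take
finitely many values. If p - q and p' - q' nearly agree, then p - p' is nearly q - q', hence an
almost period of both functions.
\<close>

lemma almost_periods_common:
  assumes f: "almost_periodic f" and g: "almost_periodic g" and e: "\<epsilon> > 0"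
  shows "relatively_dense (almost_periods f \<epsilon> \<inter> almost_periods g \<epsilon>)"
proof -
  have e2: "\<epsilon>/2 > 0" and e4: "\<epsilon>/4 > 0" using e by simp_all
  obtain l1 where l1: "l1 > 0" "\<forall>u. \<exists>\<tau>\<in>almost_periods f (\<epsilon>/2). u \<le> \<tau> \<and> \<tau> \<le> u + l1"
    using almost_period_in_interval[OF f e2] by blast
  obtain l2 where l2: "l2 > 0" "\<forall>u. \<exists>\<tau>\<in>almost_periods g (\<epsilon>/4). u \<le> \<tau> \<and> \<tau> \<le> u + l2"
    using almost_period_in_interval[OF g e4] by blast
  obtain d where d: "d > 0" "\<And>s t. \<bar>s - t\<bar> < d \<Longrightarrow> norm (g s - g t) < \<epsilon>/2"
    using almost_periodic_uniformly_continuous[OF g e2] by blast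
  obtain p where p: "\<And>u. p u \<in> almost_periods f (\<epsilon>/2) \<and> u \<le> p u \<and> p u \<le> u + l1"
    using l1(2) by metis
  obtain q where q: "\<And>u. q u \<in> almost_periods g (\<epsilon>/4) \<and> u \<le> q u \<and> q u \<le> u + l2"
    using l2(2) by metis
  \<comment> \<open>The pigeonholes: k u is the cell of length d that contains p u - q u.\<close>
  define k where "k u = \<lfloor>(p u - q u) / d\<rfloor>" for u
  have "k u \<in> {\<lfloor>- l2 / d\<rfloor>..\<lfloor>l1 / d\<rfloor>}" for u
  proof -
    have "- l2 \<le> p u - q u" "p u - q u \<le> l1" using p[of u] q[of u] by linarith+
    then have "- l2 / d \<le> (p u - q u) / d" "(p u - q u) / d \<le> l1 / d"
      using d(1) by (intro divide_right_mono; simp)+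
    then show ?thesis unfolding k_def by (simp add: floor_mono)
  qed
  then have "finite (range k)" by (meson finite_atLeastAtMost_int finite_subset image_subsetI)
  then obtain Y where Y: "finite Y" "range k = k ` Y"
    by (metis finite_subset_image subset_UNIV subset_refl)
  obtain R where R: "R > 0" "\<And>r. r \<in> Y \<Longrightarrow> \<bar>p r\<bar> \<le> R"
  proof -
    have "bounded (p ` Y)" using Y(1) by (simp add: finite_imp_bounded)
    then obtain R where "R > 0" "\<forall>x\<in>p ` Y. norm x \<le> R" using bounded_pos by blast
    then show thesis by (intro that[of R]) auto
  qed
  have "(almost_periods f \<epsilon> \<inter> almost_periods g \<epsilon>) \<inter> {v..v + (l1 + 2 * R)} \<noteq> {}" for v
  proof -
    \<comment> \<open>The almost period of f and g will be p u - p r with r in Y; starting at v + R compensates for p r.\<close>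
    define u where "u = v + R"
    obtain r where r: "r \<in> Y" "k u = k r" using Y(2) by (metis imageE rangeI)
    let ?\<tau> = "p u - p r" and ?\<sigma> = "q u - q r"
    have "?\<tau> \<in> almost_periods f (\<epsilon>/2 + \<epsilon>/2)" by (intro almost_period_diff) (use p in blast)+
    then have 1: "?\<tau> \<in> almost_periods f \<epsilon>" by simp
    have "?\<sigma> \<in> almost_periods g (\<epsilon>/4 + \<epsilon>/4)" by (intro almost_period_diff) (use q in blast)+
    then have s: "norm (g (t + ?\<sigma>) - g t) < \<epsilon>/2" for t by (auto dest: almost_periodsD)
    have "\<bar>(p u - q u) / d - (p r - q r) / d\<bar> < 1"
      using r(2) unfolding k_def by linarith
    then have "\<bar>(p u - q u) - (p r - q r)\<bar> < d"
      using d(1) by (simp add: diff_divide_distrib[symmetric])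
    then have near: "\<bar>?\<tau> - ?\<sigma>\<bar> < d" by (simp add: algebra_simps)
    have "norm (g (t + ?\<tau>) - g t) < \<epsilon>" for t
    proof -
      have "norm (g (t + ?\<tau>) - g (t + ?\<sigma>)) < \<epsilon>/2" using near by (intro d(2)) (simp add: algebra_simps)
      then show ?thesis using s[of t] norm_triangle_ineq[of "g (t + ?\<tau>) - g (t + ?\<sigma>)" "g (t + ?\<sigma>) - g t"]
        by simp
    qed
    then have 2: "?\<tau> \<in> almost_periods g \<epsilon>" by (rule almost_periodsI)
    have "v \<le> ?\<tau>" "?\<tau> \<le> v + (l1 + 2 * R)"
      using p[of u] R(2)[OF r(1)] unfolding u_def by linarith+
    then show ?thesis using 1 2 by auto
  qed
  then show ?thesis unfolding relatively_dense_def
    using R(1) l1(1) by (intro exI[of _ "l1 + 2 * R"]) auto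
qed

lemma relatively_dense_mono: "relatively_dense A \<Longrightarrow> A \<subseteq> B \<Longrightarrow> relatively_dense B"
  unfolding relatively_dense_def by blast

lemma almost_periodic_add:
  assumes f: "almost_periodic f" and g: "almost_periodic g"
  shows "almost_periodic (\<lambda>t. f t + g t)"
  unfolding almost_periodic_iff
proof (intro conjI allI impI)
  show "continuous_on UNIV (\<lambda>t. f t + g t)"
    using f g by (intro continuous_on_add almost_periodicD_cont)
  fix \<epsilon> :: real assume e: "\<epsilon> > 0"
  have "almost_periods f (\<epsilon>/2) \<inter> almost_periods g (\<epsilon>/2) \<subseteq> almost_periods (\<lambda>t. f t + g t) \<epsilon>"
  proof (intro subsetI almost_periodsI, elim IntE)
    fix \<tau> t assume "\<tau> \<in> almost_periods f (\<epsilon>/2)" "\<tau> \<in> almost_periods g (\<epsilon>/2)"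
    then have "norm (f (t + \<tau>) - f t) < \<epsilon>/2" "norm (g (t + \<tau>) - g t) < \<epsilon>/2"
      by (auto dest: almost_periodsD)
    then show "norm (f (t + \<tau>) + g (t + \<tau>) - (f t + g t)) < \<epsilon>"
      unfolding add_diff_add by (intro norm_triangle_lt) simp
  qed
  then show "relatively_dense (almost_periods (\<lambda>t. f t + g t) \<epsilon>)"
    using almost_periods_common[OF f g, of "\<epsilon>/2"] e by (meson half_gt_zero relatively_dense_mono)
qed

lemma almost_periodic_mult:
  assumes f: "almost_periodic f" and g: "almost_periodic g"
  shows "almost_periodic (\<lambda>t. f t * g t)"
  unfolding almost_periodic_iff
proof (intro conjI allI impI)
  show "continuous_on UNIV (\<lambda>t. f t * g t)"
    using f g by (intro continuous_on_mult almost_periodicD_cont)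
  fix \<epsilon> :: real assume e: "\<epsilon> > 0"
  obtain A where A: "A > 0" "\<And>t. norm (f t) \<le> A" using almost_periodic_bounded[OF f] by blast
  obtain B where B: "B > 0" "\<And>t. norm (g t) \<le> B" using almost_periodic_bounded[OF g] by blast
  define \<eta> where "\<eta> = \<epsilon> / (A + B)"
  have "\<eta> > 0" "\<eta> * (A + B) = \<epsilon>" using e A(1) B(1) by (auto simp: \<eta>_def)
  then have \<eta>: "\<eta> > 0" "\<eta> * A + \<eta> * B = \<epsilon>" by (simp_all add: distrib_left)
  have "almost_periods f \<eta> \<inter> almost_periods g \<eta> \<subseteq> almost_periods (\<lambda>t. f t * g t) \<epsilon>"
  proof (clarsimp simp: almost_periods_def)
    fix \<tau> t assume f': "\<forall>t. norm (f (t + \<tau>) - f t) < \<eta>" and g': "\<forall>t. norm (g (t + \<tau>) - g t) < \<eta>"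
    have "f (t + \<tau>) * g (t + \<tau>) - f t * g t = f (t + \<tau>) * (g (t + \<tau>) - g t) + (f (t + \<tau>) - f t) * g t"
      by (simp add: algebra_simps)
    then have "norm (f (t + \<tau>) * g (t + \<tau>) - f t * g t)
        \<le> norm (f (t + \<tau>)) * norm (g (t + \<tau>) - g t) + norm (f (t + \<tau>) - f t) * norm (g t)"
      by (metis norm_mult norm_triangle_ineq)
    also have "\<dots> \<le> A * norm (g (t + \<tau>) - g t) + norm (f (t + \<tau>) - f t) * B"
      by (intro add_mono mult_mono A B) (use A(1) in auto)
    also have "\<dots> < A * \<eta> + \<eta> * B"
      using A(1) B(1) f' g' by (intro add_strict_mono mult_strict_left_mono mult_strict_right_mono) auto
    finally show "norm (f (t + \<tau>) * g (t + \<tau>) - f t * g t) < \<epsilon>" using \<eta>(2) by (simp add: mult.commute)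
  qed
  then show "relatively_dense (almost_periods (\<lambda>t. f t * g t) \<epsilon>)"
    using almost_periods_common[OF f g \<eta>(1)] by (meson relatively_dense_mono)
qed

lemma almost_periodic_periodic:
  assumes "continuous_on UNIV f" "p > 0" "\<And>t. f (t + p) = f t"
  shows "almost_periodic f"
  unfolding almost_periodic_iff
proof (intro conjI allI impI)
  show "continuous_on UNIV f" by (fact assms(1))
  fix \<epsilon> :: real assume e: "\<epsilon> > 0"
  have per: "f (t + of_nat n * p) = f t" for n :: nat and t
  proof (induction n arbitrary: t)
    case (Suc n)
    then show ?case using assms(3)[of "t + of_nat n * p"] by (simp add: algebra_simps)
  qed simp
  have per': "f (t + of_int m * p) = f t" for m :: int and t
  proof (cases m rule: int_cases2)
    case (nonneg n) then show ?thesis using per by simp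
  next
    case (nonpos n) then show ?thesis using per[of "t + of_int m * p" n] by simp
  qed
  have "almost_periods f \<epsilon> \<inter> {u..u + p} \<noteq> {}" for u
  proof -
    define m where "m = \<lceil>u / p\<rceil>"
    have "u / p \<le> of_int m" "of_int m \<le> u / p + 1" unfolding m_def by linarith+
    then have "of_int m * p \<in> {u..u + p}" using assms(2) by (simp add: field_simps)
    moreover have "of_int m * p \<in> almost_periods f \<epsilon>" using per' e by (intro almost_periodsI) simp
    ultimately show ?thesis by blast
  qed
  then show "relatively_dense (almost_periods f \<epsilon>)" unfolding relatively_dense_def using assms(2) by blast
qed

lemma almost_periodic_const: "almost_periodic (\<lambda>t. c)"
  by (rule almost_periodic_periodic[of _ 1]) auto

lemma almost_periodic_cis: "almost_periodic (\<lambda>t. cis (w * t))"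
proof (cases "w = 0")
  case False
  have "cis (w * (t + 2 * pi / \<bar>w\<bar>)) = cis (w * t)" for t
  proof -
    have "w * (t + 2 * pi / \<bar>w\<bar>) = w * t + sgn w * (2 * pi)"
      using False by (simp add: field_simps sgn_if)
    then show ?thesis using False by (cases "w > 0") (simp_all add: cis_mult[symmetric] cis_divide[symmetric])
  qed
  then show ?thesis
    using False by (intro almost_periodic_periodic[of _ "2 * pi / \<bar>w\<bar>"] continuous_intros) auto
qed (use almost_periodic_const[of 1] in simp)

lemma almost_periodic_cmult: "almost_periodic f \<Longrightarrow> almost_periodic (\<lambda>t. c * f t)"
  by (rule almost_periodic_mult[OF almost_periodic_const])

lemma almost_periodic_diff:
  assumes "almost_periodic f" "almost_periodic g"
  shows "almost_periodic (\<lambda>t. f t - g t)"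
  using almost_periodic_add[OF assms(1) almost_periodic_cmult[OF assms(2), of "-1"]] by simp

lemma almost_periodic_shift:
  assumes f: "almost_periodic f"
  shows "almost_periodic (\<lambda>t. f (t + s))"
  unfolding almost_periodic_iff
proof (intro conjI allI impI)
  show "continuous_on UNIV (\<lambda>t. f (t + s))"
    by (rule continuous_on_compose2[OF almost_periodicD_cont[OF f]]) (auto intro: continuous_intros)
  fix \<epsilon> :: real assume e: "\<epsilon> > 0"
  have "almost_periods f \<epsilon> \<subseteq> almost_periods (\<lambda>t. f (t + s)) \<epsilon>"
  proof (clarsimp simp: almost_periods_def)
    fix \<tau> t assume "\<forall>t. norm (f (t + \<tau>) - f t) < \<epsilon>"
    then have "norm (f (t + s + \<tau>) - f (t + s)) < \<epsilon>" by blast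
    then show "norm (f (t + \<tau> + s) - f (t + s)) < \<epsilon>" by (simp add: algebra_simps)
  qed
  then show "relatively_dense (almost_periods (\<lambda>t. f (t + s)) \<epsilon>)"
    using f e by (auto simp: almost_periodic_iff intro: relatively_dense_mono)
qed

lemma almost_periodic_reflect:
  assumes f: "almost_periodic f"
  shows "almost_periodic (\<lambda>t. f (- t))"
  unfolding almost_periodic_iff
proof (intro conjI allI impI)
  show "continuous_on UNIV (\<lambda>t. f (- t))"
    by (rule continuous_on_compose2[OF almost_periodicD_cont[OF f]]) (auto intro: continuous_intros)
  fix \<epsilon> :: real assume e: "\<epsilon> > 0"
  have "almost_periods f \<epsilon> \<subseteq> almost_periods (\<lambda>t. f (- t)) \<epsilon>"
  proof
    fix \<tau> assume "\<tau> \<in> almost_periods f \<epsilon>"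
    from almost_periodsD[OF almost_period_uminus[OF this], of "- t" for t]
    show "\<tau> \<in> almost_periods (\<lambda>t. f (- t)) \<epsilon>" by (intro almost_periodsI) simp
  qed
  then show "relatively_dense (almost_periods (\<lambda>t. f (- t)) \<epsilon>)"
    using f e by (auto simp: almost_periodic_iff intro: relatively_dense_mono)
qed

section \<open>Mean values and spectral gaps\<close>

lemma continuous_integrable: "continuous_on UNIV f \<Longrightarrow> f integrable_on {a..b}" for f :: "real \<Rightarrow> complex"
  by (intro integrable_continuous_interval) (auto intro: continuous_on_subset)

lemma continuous_shift:
  "continuous_on UNIV f \<Longrightarrow> continuous_on UNIV (\<lambda>t. f (t + s))" for f :: "real \<Rightarrow> complex"
  by (rule continuous_on_compose2[of UNIV f]) (auto intro: continuous_intros)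

lemma integral_split:
  fixes f :: "real \<Rightarrow> complex"
  assumes "continuous_on UNIV f" "a \<le> c" "c \<le> b"
  shows "integral {a..b} f = integral {a..c} f + integral {c..b} f"
  using Henstock_Kurzweil_Integration.integral_combine[OF assms(2,3) continuous_integrable[OF assms(1)]] by simp

lemma norm_integral_le:
  fixes f :: "real \<Rightarrow> complex"
  assumes "continuous_on UNIV f" "a \<le> b" "\<And>t. t \<in> {a..b} \<Longrightarrow> norm (f t) \<le> B"
  shows "norm (integral {a..b} f) \<le> B * (b - a)"
  using assms by (intro integral_bound) (auto intro: continuous_on_subset)

lemma norm_integral_diff_le:
  fixes f :: "real \<Rightarrow> complex"
  assumes "continuous_on UNIV f" "continuous_on UNIV g" "a \<le> b" "\<And>t. t \<in> {a..b} \<Longrightarrow> norm (f t - g t) \<le> B"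
  shows "norm (integral {a..b} f - integral {a..b} g) \<le> B * (b - a)"
proof -
  have "integral {a..b} f - integral {a..b} g = integral {a..b} (\<lambda>t. f t - g t)"
    using assms by (intro integral_diff[symmetric] continuous_integrable)
  also have "norm \<dots> \<le> B * (b - a)"
    using assms by (intro norm_integral_le continuous_intros)
  finally show ?thesis .
qed

text \<open>
Cut the long interval into blocks of length L; what remains is shorter than a block and contributes at most C L.
\<close>

lemma integral_block_bound:
  fixes g :: "real \<Rightarrow> complex"
  assumes cont: "continuous_on UNIV g" and C: "\<And>t. norm (g t) \<le> C" and L: "L > 0"
    and block: "\<And>a. norm (integral {a..a+L} g) \<le> \<kappa> * L" and X: "X \<ge> 0"
  shows "norm (integral {a..a+X} g) \<le> \<kappa> * X + C * L"
proof -
  have \<kappa>: "\<kappa> \<ge> 0" using block[of 0] L norm_ge_zero order_trans zero_le_mult_iff by (metis less_le_not_le)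
  have C0: "C \<ge> 0" using C[of 0] norm_ge_zero order_trans by blast
  have blocks: "norm (integral {a..a + real n * L} g) \<le> \<kappa> * (real n * L)" for n
  proof (induction n)
    case (Suc n)
    have "integral {a..a + real (Suc n) * L} g
        = integral {a..a + real n * L} g + integral {a + real n * L..a + real (Suc n) * L} g"
      using L by (intro integral_split cont) auto
    moreover have "norm (integral {a + real n * L..a + real (Suc n) * L} g) \<le> \<kappa> * L"
      using block[of "a + real n * L"] by (simp add: algebra_simps)
    ultimately have "norm (integral {a..a + real (Suc n) * L} g) \<le> \<kappa> * (real n * L) + \<kappa> * L"
      using Suc.IH norm_triangle_ineq[of "integral {a..a + real n * L} g"] by (smt (verit))
    then show ?case by (simp add: algebra_simps)
  qed simp
  define n where "n = nat \<lfloor>X / L\<rfloor>"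
  have "real n \<le> X / L" "X / L \<le> real n + 1"
    using X L unfolding n_def by (auto simp: of_nat_nat)
  then have n: "real n * L \<le> X" "X \<le> real n * L + L" using L by (auto simp: field_simps)
  have "integral {a..a + X} g = integral {a..a + real n * L} g + integral {a + real n * L..a + X} g"
    using L n by (intro integral_split cont) auto
  moreover have "norm (integral {a + real n * L..a + X} g) \<le> C * ((a + X) - (a + real n * L))"
    using n by (intro norm_integral_le cont C) auto
  moreover have "C * ((a + X) - (a + real n * L)) \<le> C * L" using n C0 by (intro mult_left_mono) auto
  moreover have "\<kappa> * (real n * L) \<le> \<kappa> * X" using n \<kappa> by (intro mult_left_mono) auto
  ultimately show ?thesis using blocks[of n] norm_triangle_ineq[of "integral {a..a + real n * L} g" "integral {a + real n * L..a + X} g"]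
    by simp
qed

text \<open>
The mean value is required to vanish uniformly in the position of the window. For almost periodic
functions this is no stronger than a vanishing limit over the windows [-T, T].
\<close>

definition mean_zero :: "(real \<Rightarrow> complex) \<Rightarrow> bool" where
  "mean_zero g \<longleftrightarrow>
     (\<forall>\<epsilon>>0. \<exists>L0>0. \<forall>L\<ge>L0. \<forall>a. norm (integral {a..a+L} g) \<le> \<epsilon> * L)"

text \<open>
A window of length L can be moved by at most l so as to start at an almost period \<tau>, which changes
the integral by at most 2 C l, and from there to the origin, which changes it by at most \<epsilon> L / 4.
So the averages over all windows of a suitable length L are close to the same number k.
\<close>

lemma almost_periodic_approx_mean:
  assumes g: "almost_periodic g" and e: "\<epsilon> > 0"
  shows "\<exists>k. \<exists>X0>0. \<forall>X\<ge>X0. \<forall>a. norm (integral {a..a+X} (\<lambda>t. g t - k)) \<le> \<epsilon> * X"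
proof -
  have cont: "continuous_on UNIV g" using g by (rule almost_periodicD_cont)
  obtain C where C: "C > 0" "\<forall>t. norm (g t) \<le> C" using almost_periodic_bounded[OF g] by blast
  have "\<epsilon>/4 > 0" using e by simp
  then obtain l where l: "l > 0" "\<forall>u. \<exists>\<tau>\<in>almost_periods g (\<epsilon>/4). u \<le> \<tau> \<and> \<tau> \<le> u + l"
    using almost_period_in_interval[OF g, of "\<epsilon>/4"] by blast
  \<comment> \<open>This length makes the loss 2 C l at the two ends equal to \<epsilon> L / 4.\<close>
  define L where "L = 8 * C * l / \<epsilon>"
  have L: "L > 0" "2 * C * l = \<epsilon>/4 * L" using C l e by (auto simp: L_def)
  define k where "k = integral {0..L} g / of_real L"
  have block: "norm (integral {a..a+L} (\<lambda>t. g t - k)) \<le> \<epsilon>/2 * L" for a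
  proof -
    obtain \<tau> where \<tau>: "\<tau> \<in> almost_periods g (\<epsilon>/4)" "a \<le> \<tau>" "\<tau> \<le> a + l" using l(2) by blast
    have "integral {a..a+L} g + integral {a+L..\<tau>+L} g = integral {a..\<tau>} g + integral {\<tau>..\<tau>+L} g"
      using \<tau> L integral_split[OF cont, of a "a+L" "\<tau>+L"] integral_split[OF cont, of a "\<tau>" "\<tau>+L"] by simp
    then have 1: "integral {a..a+L} g = integral {a..\<tau>} g + integral {\<tau>..\<tau>+L} g - integral {a+L..\<tau>+L} g"
      by (metis add_diff_cancel_right')
    have "norm (integral {a..\<tau>} g) \<le> C * (\<tau> - a)" "norm (integral {a+L..\<tau>+L} g) \<le> C * ((\<tau>+L) - (a+L))"
      using \<tau> C by (intro norm_integral_le cont; simp)+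
    moreover have "C * (\<tau> - a) \<le> C * l" using C \<tau> by (intro mult_left_mono) auto
    ultimately have 2: "norm (integral {a..\<tau>} g) \<le> C * l" "norm (integral {a+L..\<tau>+L} g) \<le> C * l" by auto
    have "integral {\<tau>..\<tau>+L} g = integral {0..L} (\<lambda>t. g (t + \<tau>))"
      using integral_shift[of 0 \<tau> L g] continuous_on_subset[OF cont]
      by (simp add: o_def add.commute)
    then have 3: "norm (integral {\<tau>..\<tau>+L} g - integral {0..L} g) \<le> \<epsilon>/4 * (L - 0)"
      using L(1) almost_periodsD[OF \<tau>(1)]
      by (simp only:) (intro norm_integral_diff_le continuous_shift cont less_imp_le)
    have kL: "k * of_real L = integral {0..L} g" using L by (simp add: k_def)
    have "integral {a..a+L} (\<lambda>t. g t - k) = integral {a..a+L} g - k * of_real L"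
      using L by (subst integral_diff) (auto intro: continuous_integrable cont simp: scaleR_conv_of_real mult.commute)
    also have "\<dots> = integral {a..\<tau>} g + (integral {\<tau>..\<tau>+L} g - integral {0..L} g) - integral {a+L..\<tau>+L} g"
      unfolding kL 1 by simp
    also have "norm \<dots> \<le> C * l + \<epsilon>/4 * L + C * l"
      by (rule order_trans[OF norm_triangle_ineq4], rule add_mono, rule order_trans[OF norm_triangle_ineq], rule add_mono)
        (use 2 3 in auto)
    also have "\<dots> = \<epsilon>/2 * L" using L(2) by (simp add: field_simps)
    finally show ?thesis .
  qed
  define C' where "C' = C + norm k"
  have bd: "norm (g t - k) \<le> C'" for t
    unfolding C'_def using C(2) by (intro order_trans[OF norm_triangle_ineq4] add_mono) auto
  define X0 where "X0 = 2 * C' * L / \<epsilon>"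
  have "C' > 0" using C(1) unfolding C'_def by (simp add: add_pos_nonneg)
  then have X0: "X0 > 0" "C' * L = \<epsilon>/2 * X0" using L(1) e unfolding X0_def by auto
  have "norm (integral {a..a+X} (\<lambda>t. g t - k)) \<le> \<epsilon> * X" if X: "X \<ge> X0" for X a
  proof -
    have "norm (integral {a..a+X} (\<lambda>t. g t - k)) \<le> \<epsilon>/2 * X + C' * L"
      using X X0 by (intro integral_block_bound bd L block continuous_intros cont) auto
    also have "C' * L \<le> \<epsilon>/2 * X" unfolding X0(2) using X e by (intro mult_left_mono) auto
    finally show ?thesis by (simp add: field_simps)
  qed
  then show ?thesis using X0(1) by blast
qed

text \<open>
By \<open>almost_periodic_approx_mean\<close> the symmetric averages m(T) are, for all large T, within \<epsilon> of some
number k, so they form a Cauchy family; all long averages, wherever they are taken, approach the same limit.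
\<close>

lemma almost_periodic_mean:
  assumes g: "almost_periodic g"
  shows "\<exists>c. ((\<lambda>T. 1 / (2 * of_real T) * integral {-T..T} g) \<longlongrightarrow> c) at_top \<and> mean_zero (\<lambda>t. g t - c)"
proof -
  have cont: "continuous_on UNIV g" using g by (rule almost_periodicD_cont)
  define m where "m T = 1 / (2 * of_real T) * integral {-T..T} g" for T :: real
  have approx: "\<exists>k. \<exists>X0>0. (\<forall>X\<ge>X0. \<forall>a. norm (integral {a..a+X} (\<lambda>t. g t - k)) \<le> \<epsilon> * X) \<and> (\<forall>T\<ge>X0. norm (m T - k) \<le> \<epsilon>)"
    if "\<epsilon> > 0" for \<epsilon>
  proof -
    obtain k X0 where k: "X0 > 0" "\<forall>X\<ge>X0. \<forall>a. norm (integral {a..a+X} (\<lambda>t. g t - k)) \<le> \<epsilon> * X"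
      using almost_periodic_approx_mean[OF g \<open>\<epsilon> > 0\<close>] by blast
    have "norm (m T - k) \<le> \<epsilon>" if "T \<ge> X0" for T
    proof -
      have T: "T > 0" using that k(1) by simp
      have "norm (integral {-T..-T+2*T} (\<lambda>t. g t - k)) \<le> \<epsilon> * (2 * T)"
        using k T that by (intro k(2)[rule_format]) auto
      moreover have "integral {-T..-T+2*T} (\<lambda>t. g t - k) = integral {-T..T} g - k * of_real (2 * T)"
        using T by (subst integral_diff) (auto intro: continuous_integrable cont simp: scaleR_conv_of_real mult.commute)
      moreover have "m T - k = (integral {-T..T} g - k * of_real (2 * T)) / of_real (2 * T)"
        using T by (simp add: m_def field_simps)
      ultimately show ?thesis using T by (simp add: norm_divide norm_mult divide_le_eq)
    qed
    then show ?thesis using k by blast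
  qed
  have "Cauchy (\<lambda>n. m (real n))"
  proof (rule CauchyI)
    fix e :: real assume "e > 0"
    then have "e/3 > 0" by simp
    from approx[OF this] obtain k X0 where k: "\<forall>T\<ge>X0. norm (m T - k) \<le> e/3" by blast
    obtain N where N: "real N \<ge> X0" using real_arch_simple by blast
    have "norm (m (real i) - m (real j)) < e" if "i \<ge> N" "j \<ge> N" for i j
    proof -
      have "norm (m (real i) - k) \<le> e/3" "norm (m (real j) - k) \<le> e/3"
        using k that N by auto
      moreover have "m (real i) - m (real j) = (m (real i) - k) - (m (real j) - k)" by simp
      ultimately show ?thesis using \<open>e > 0\<close> norm_triangle_ineq4[of "m (real i) - k" "m (real j) - k"] by simp
    qed
    then show "\<exists>M. \<forall>i\<ge>M. \<forall>j\<ge>M. norm (m (real i) - m (real j)) < e" by blast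
  qed
  then obtain c where c: "(\<lambda>n. m (real n)) \<longlonglongrightarrow> c"
    using Cauchy_convergent_iff convergent_def by blast
  have close: "norm (c - k) \<le> \<epsilon>" if k: "\<forall>T\<ge>X0. norm (m T - k) \<le> \<epsilon>" for k X0 \<epsilon>
  proof (rule tendsto_upperbound)
    show "(\<lambda>n. norm (m (real n) - k)) \<longlonglongrightarrow> norm (c - k)" by (intro tendsto_intros c)
    show "\<forall>\<^sub>F n in sequentially. norm (m (real n) - k) \<le> \<epsilon>"
      using k eventually_ge_at_top[of "nat \<lceil>X0\<rceil>"] by (auto elim!: eventually_mono simp: nat_ceiling_le_eq)
  qed simp
  have "(m \<longlongrightarrow> c) at_top"
  proof (rule tendstoI)
    fix e :: real assume "e > 0"
    then have "e/3 > 0" by simp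
    from approx[OF this] obtain k X0 where k: "\<forall>T\<ge>X0. norm (m T - k) \<le> e/3" by blast
    have "dist (m T) c < e" if "T \<ge> X0" for T
    proof -
      have "m T - c = (m T - k) - (c - k)" by simp
      then have "norm (m T - c) \<le> e/3 + e/3"
        using k close[OF k] that by (metis add_mono norm_triangle_ineq4 order_trans)
      then show ?thesis using \<open>e > 0\<close> by (simp add: dist_norm)
    qed
    then show "\<forall>\<^sub>F T in at_top. dist (m T) c < e" using eventually_at_top_linorder by blast
  qed
  moreover have "mean_zero (\<lambda>t. g t - c)"
    unfolding mean_zero_def
  proof (intro allI impI)
    fix \<epsilon> :: real assume "\<epsilon> > 0"
    then have "\<epsilon>/2 > 0" by simp
    from approx[OF this] obtain k X0 where X0: "X0 > 0"
      and k1: "\<forall>X\<ge>X0. \<forall>a. norm (integral {a..a+X} (\<lambda>t. g t - k)) \<le> \<epsilon>/2 * X"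
      and k2: "\<forall>T\<ge>X0. norm (m T - k) \<le> \<epsilon>/2" by blast
    have "norm (integral {a..a+L} (\<lambda>t. g t - c)) \<le> \<epsilon> * L" if L: "L \<ge> X0" for a L
    proof -
      have "norm (integral {a..a+L} (\<lambda>t. g t - c) - integral {a..a+L} (\<lambda>t. g t - k)) \<le> \<epsilon>/2 * (a + L - a)"
        using L X0 close[OF k2] by (intro norm_integral_diff_le continuous_intros cont) (auto simp: norm_minus_commute)
      moreover have "norm (integral {a..a+L} (\<lambda>t. g t - k)) \<le> \<epsilon>/2 * L" using k1 L by blast
      ultimately show ?thesis
        using norm_triangle_sub[of "integral {a..a+L} (\<lambda>t. g t - c)" "integral {a..a+L} (\<lambda>t. g t - k)"] by simp
    qed
    then show "\<exists>L0>0. \<forall>L\<ge>L0. \<forall>a. norm (integral {a..a+L} (\<lambda>t. g t - c)) \<le> \<epsilon> * L"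
      using X0 by blast
  qed
  ultimately show ?thesis unfolding m_def by blast
qed

text \<open>
The set of frequencies is defined by limits that exist and are nonzero. For an almost periodic function
the limit always exists, so the only reason for not being a frequency is a zero mean value.
\<close>

lemma not_Freq_imp_mean_zero:
  assumes f: "almost_periodic f" and w: "w \<notin> Freq f"
  shows "mean_zero (\<lambda>t. f t * cis (- (w * t)))"
proof -
  have "almost_periodic (\<lambda>t. f t * cis (- (w * t)))"
    using almost_periodic_mult[OF f almost_periodic_cis[of "-w"]] by simp
  then obtain c where c: "((\<lambda>T. 1 / (2 * of_real T) * integral {-T..T} (\<lambda>t. f t * cis (- (w * t)))) \<longlongrightarrow> c) at_top"
      "mean_zero (\<lambda>t. f t * cis (- (w * t)) - c)"
    using almost_periodic_mean by blast
  have "(\<lambda>t. f t * cis (- (w * t))) = (\<lambda>t. f t * exp (- (\<i> * of_real w * of_real t)))"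
    by (simp add: cis_conv_exp mult.assoc)
  then have "c = 0" using w c(1) unfolding Freq_def by auto
  then show ?thesis using c(2) by simp
qed

lemma mean_zero_add:
  assumes "mean_zero f" "mean_zero g" "continuous_on UNIV f" "continuous_on UNIV g"
  shows "mean_zero (\<lambda>t. f t + g t)"
  unfolding mean_zero_def
proof (intro allI impI)
  fix \<epsilon> :: real assume "\<epsilon> > 0"
  then have e: "\<epsilon>/2 > 0" by simp
  obtain L1 where L1: "L1 > 0" "\<forall>L\<ge>L1. \<forall>a. norm (integral {a..a+L} f) \<le> \<epsilon>/2 * L"
    using assms(1) e unfolding mean_zero_def by blast
  obtain L2 where L2: "L2 > 0" "\<forall>L\<ge>L2. \<forall>a. norm (integral {a..a+L} g) \<le> \<epsilon>/2 * L"
    using assms(2) e unfolding mean_zero_def by blast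
  have "norm (integral {a..a+L} (\<lambda>t. f t + g t)) \<le> \<epsilon> * L" if "L \<ge> max L1 L2" for L a
  proof -
    have "integral {a..a+L} (\<lambda>t. f t + g t) = integral {a..a+L} f + integral {a..a+L} g"
      using assms by (intro integral_add continuous_integrable)
    moreover have "norm (integral {a..a+L} f) \<le> \<epsilon>/2 * L" "norm (integral {a..a+L} g) \<le> \<epsilon>/2 * L"
      using L1 L2 that by auto
    ultimately show ?thesis using norm_triangle_ineq[of "integral {a..a+L} f" "integral {a..a+L} g"] by simp
  qed
  then show "\<exists>L0>0. \<forall>L\<ge>L0. \<forall>a. norm (integral {a..a+L} (\<lambda>t. f t + g t)) \<le> \<epsilon> * L"
    using L1(1) by (intro exI[of _ "max L1 L2"]) auto
qed

lemma mean_zero_cmult: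
  assumes "mean_zero f"
  shows "mean_zero (\<lambda>t. c * f t)"
  unfolding mean_zero_def
proof (intro allI impI)
  fix \<epsilon> :: real assume "\<epsilon> > 0"
  then have e: "\<epsilon> / (norm c + 1) > 0" by (simp add: add_nonneg_pos)
  then obtain L0 where L0: "L0 > 0" "\<forall>L\<ge>L0. \<forall>a. norm (integral {a..a+L} f) \<le> \<epsilon> / (norm c + 1) * L"
    using assms unfolding mean_zero_def by blast
  have "norm (integral {a..a+L} (\<lambda>t. c * f t)) \<le> \<epsilon> * L" if "L \<ge> L0" for L a
  proof -
    have L: "L > 0" using L0 that by simp
    have "norm (integral {a..a+L} (\<lambda>t. c * f t)) = norm c * norm (integral {a..a+L} f)"
      by (simp add: norm_mult)
    also have "\<dots> \<le> (norm c + 1) * (\<epsilon> / (norm c + 1) * L)"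
      using L0 that by (intro mult_mono) auto
    also have "\<dots> = \<epsilon> * L"
      using add_nonneg_pos[OF norm_ge_zero[of c] zero_less_one] by simp
    finally show ?thesis .
  qed
  then show "\<exists>L0>0. \<forall>L\<ge>L0. \<forall>a. norm (integral {a..a+L} (\<lambda>t. c * f t)) \<le> \<epsilon> * L"
    using L0(1) by blast
qed

lemma mean_zero_shift:
  assumes f: "mean_zero f" "continuous_on UNIV f"
  shows "mean_zero (\<lambda>t. f (t + s))"
  unfolding mean_zero_def
proof (intro allI impI)
  fix \<epsilon> :: real assume "\<epsilon> > 0"
  then obtain L0 where L0: "L0 > 0" "\<forall>L\<ge>L0. \<forall>a. norm (integral {a..a+L} f) \<le> \<epsilon> * L"
    using f unfolding mean_zero_def by blast
  have "integral {a..a+L} (\<lambda>t. f (t + s)) = integral {a+s..a+s+L} f" for a L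
    using integral_shift[of a s "a+L" f] continuous_on_subset[OF f(2)] by (simp add: o_def add_ac)
  then show "\<exists>L0>0. \<forall>L\<ge>L0. \<forall>a. norm (integral {a..a+L} (\<lambda>t. f (t + s))) \<le> \<epsilon> * L"
    using L0 by auto
qed

lemma mean_zero_reflect:
  assumes "mean_zero f"
  shows "mean_zero (\<lambda>t. f (- t))"
  unfolding mean_zero_def
proof (intro allI impI)
  fix \<epsilon> :: real assume "\<epsilon> > 0"
  then obtain L0 where L0: "L0 > 0" "\<forall>L\<ge>L0. \<forall>a. norm (integral {a..a+L} f) \<le> \<epsilon> * L"
    using assms unfolding mean_zero_def by blast
  have "norm (integral {a..a+L} (\<lambda>t. f (- t))) \<le> \<epsilon> * L" if "L \<ge> L0" for L a
    using L0(2)[rule_format, OF that, of "- a - L"]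
      Henstock_Kurzweil_Integration.integral_reflect_real[of "-a" "-a-L" f] by (simp add: algebra_simps)
  then show "\<exists>L0>0. \<forall>L\<ge>L0. \<forall>a. norm (integral {a..a+L} (\<lambda>t. f (- t))) \<le> \<epsilon> * L"
    using L0(1) by blast
qed

text \<open>
For almost periodic f this says that no frequency lies in (-\<delta>, \<delta>). As a condition on mean values
it passes to increments of a primitive of f by interchanging integrals.
\<close>

definition spectral_gap :: "(real \<Rightarrow> complex) \<Rightarrow> real \<Rightarrow> bool" where
  "spectral_gap f \<delta> \<longleftrightarrow> (\<forall>w. \<bar>w\<bar> < \<delta> \<longrightarrow> mean_zero (\<lambda>t. f t * cis (- (w * t))))"

lemma norm_cis_minus_one_le: "norm (cis x - 1) \<le> \<bar>x\<bar>"
proof -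
  have "(norm (cis x - 1))\<^sup>2 = (cos x - 1)\<^sup>2 + (sin x)\<^sup>2" by (simp add: cmod_power2)
  also have "\<dots> = 2 - 2 * cos x" using sin_cos_squared_add[of x] by (simp add: power2_diff)
  also have "cos x = 1 - 2 * (sin (x/2))\<^sup>2" using cos_double_sin[of "x/2"] by simp
  also have "2 - 2 * (1 - 2 * (sin (x/2))\<^sup>2) = (2 * \<bar>sin (x/2)\<bar>)\<^sup>2" by (simp add: power_mult_distrib)
  finally have "norm (cis x - 1) = 2 * \<bar>sin (x/2)\<bar>" by (subst (asm) power2_eq_iff_nonneg) auto
  then show ?thesis using abs_sin_x_le_abs_x[of "x/2"] by simp
qed

lemma spectral_gap_shift:
  assumes z: "spectral_gap z \<delta>" "continuous_on UNIV z"
  shows "spectral_gap (\<lambda>t. z (t + s)) \<delta>"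
  unfolding spectral_gap_def
proof (intro allI impI)
  fix w assume "\<bar>w\<bar> < \<delta>"
  then have "mean_zero (\<lambda>t. z t * cis (- (w * t)))" using z unfolding spectral_gap_def by blast
  then have "mean_zero (\<lambda>t. z (t + s) * cis (- (w * (t + s))))"
    by (rule mean_zero_shift) (intro continuous_intros z)
  then have "mean_zero (\<lambda>t. cis (w * s) * (z (t + s) * cis (- (w * (t + s)))))" by (rule mean_zero_cmult)
  moreover have "cis (w * s) * (z (t + s) * cis (- (w * (t + s)))) = z (t + s) * cis (- (w * t))" for t
  proof -
    have "cis (w * s) * cis (- (w * (t + s))) = cis (- (w * t))" by (simp add: cis_mult algebra_simps)
    then show ?thesis by (simp only: mult.left_commute[of "cis (w * s)"])
  qed
  ultimately show "mean_zero (\<lambda>t. z (t + s) * cis (- (w * t)))" by (simp only:)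
qed

text \<open>
If the averages over blocks of length L are small at the frequency w0, then they are small at all w with
|w - w0| L small, since within one block the two exponentials differ only by a constant phase and an error
of that size. So the decay is locally uniform in w, and uniform on [-d, d] by compactness.
\<close>

lemma spectral_gap_uniform:
  assumes cont: "continuous_on UNIV f" and C: "\<And>t. norm (f t) \<le> C" and gap: "spectral_gap f \<delta>"
    and d: "d < \<delta>" and \<kappa>: "\<kappa> > 0"
  shows "\<exists>T0>0. \<forall>T\<ge>T0. \<forall>w. \<bar>w\<bar> \<le> d \<longrightarrow>
    norm (integral {-T..T} (\<lambda>t. f t * cis (- (w * t)))) \<le> \<kappa> * (2 * T)"
proof -
  have C0: "C \<ge> 0" using C[of 0] norm_ge_zero order_trans by blast
  have contw: "continuous_on UNIV (\<lambda>t. f t * cis (- (w * t)))" for w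
    by (intro continuous_intros cont)
  define P where "P w0 r X \<longleftrightarrow> (\<forall>w T. \<bar>w - w0\<bar> < r \<longrightarrow> T \<ge> X \<longrightarrow>
      norm (integral {-T..T} (\<lambda>t. f t * cis (- (w * t)))) \<le> \<kappa> * (2 * T))" for w0 r X
  have local: "\<exists>r>0. \<exists>X>0. P w0 r X"
    if w0: "\<bar>w0\<bar> \<le> d" for w0
  proof -
    have "mean_zero (\<lambda>t. f t * cis (- (w0 * t)))" using gap w0 d unfolding spectral_gap_def by auto
    moreover have "\<kappa>/4 > 0" using \<kappa> by simp
    ultimately obtain L where L: "L > 0" "\<forall>L'\<ge>L. \<forall>a. norm (integral {a..a+L'} (\<lambda>t. f t * cis (- (w0 * t)))) \<le> \<kappa>/4 * L'"
      unfolding mean_zero_def by blast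
    \<comment> \<open>The 1 in the denominator covers the case C = 0.\<close>
    define r where "r = \<kappa> / (4 * (C * L + 1))"
    have CL: "C * L + 1 > 0" using C0 L(1) by (simp add: add_nonneg_pos)
    have r: "r > 0" using \<kappa> CL by (simp add: r_def)
    have "C * L * r \<le> (C * L + 1) * r" using r by (intro mult_right_mono) auto
    also have "\<dots> = \<kappa>/4" unfolding r_def using CL by (simp add: divide_simps)
    finally have CLr: "C * L * r \<le> \<kappa>/4" .
    have block: "norm (integral {a..a+L} (\<lambda>t. f t * cis (- (w * t)))) \<le> \<kappa>/2 * L" if w: "\<bar>w - w0\<bar> < r" for w a
    proof -
      have "norm (integral {a..a+L} (\<lambda>t. f t * cis (- (w * t))))
          = norm (cis ((w - w0) * a) * integral {a..a+L} (\<lambda>t. f t * cis (- (w * t))))"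
        by (simp add: norm_mult)
      also have "cis ((w - w0) * a) * integral {a..a+L} (\<lambda>t. f t * cis (- (w * t)))
          = integral {a..a+L} (\<lambda>t. cis ((w - w0) * a) * (f t * cis (- (w * t))))"
        by simp
      finally have 1: "norm (integral {a..a+L} (\<lambda>t. f t * cis (- (w * t))))
          = norm (integral {a..a+L} (\<lambda>t. cis ((w - w0) * a) * (f t * cis (- (w * t)))))" .
      have pt: "norm (cis ((w - w0) * a) * (f t * cis (- (w * t))) - f t * cis (- (w0 * t))) \<le> \<kappa>/4"
        if t: "t \<in> {a..a+L}" for t
      proof -
        have "cis ((w - w0) * a) * (f t * cis (- (w * t)))
            = f t * cis (- (w0 * t)) * cis (- ((w - w0) * (t - a)))"
          by (simp add: cis_mult mult.assoc mult.left_commute algebra_simps)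
        then have "cis ((w - w0) * a) * (f t * cis (- (w * t))) - f t * cis (- (w0 * t))
            = f t * cis (- (w0 * t)) * (cis (- ((w - w0) * (t - a))) - 1)"
          by (simp add: algebra_simps)
        then have "norm (cis ((w - w0) * a) * (f t * cis (- (w * t))) - f t * cis (- (w0 * t)))
            = norm (f t) * norm (cis (- ((w - w0) * (t - a))) - 1)"
          by (simp add: norm_mult)
        also have "\<dots> \<le> C * (r * L)"
        proof (intro mult_mono C C0 norm_ge_zero)
          have "norm (cis (- ((w - w0) * (t - a))) - 1) \<le> \<bar>w - w0\<bar> * \<bar>t - a\<bar>"
            using norm_cis_minus_one_le[of "- ((w - w0) * (t - a))"] by (simp add: abs_mult)
          also have "\<dots> \<le> r * L" using t w r by (intro mult_mono) auto
          finally show "norm (cis (- ((w - w0) * (t - a))) - 1) \<le> r * L" .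
        qed
        also have "\<dots> \<le> \<kappa>/4" using CLr by (simp add: mult_ac)
        finally show ?thesis .
      qed
      have "norm (integral {a..a+L} (\<lambda>t. cis ((w - w0) * a) * (f t * cis (- (w * t))))
          - integral {a..a+L} (\<lambda>t. f t * cis (- (w0 * t)))) \<le> \<kappa>/4 * (a + L - a)"
        using L(1) pt by (intro norm_integral_diff_le continuous_intros cont) auto
      moreover have "norm (integral {a..a+L} (\<lambda>t. f t * cis (- (w0 * t)))) \<le> \<kappa>/4 * L" using L by blast
      ultimately show ?thesis unfolding 1
        using norm_triangle_sub[of "integral {a..a+L} (\<lambda>t. cis ((w - w0) * a) * (f t * cis (- (w * t))))"
            "integral {a..a+L} (\<lambda>t. f t * cis (- (w0 * t)))"] by simp
    qed
    define X where "X = C * L / \<kappa> + 1"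
    have X: "X > 0" "C * L \<le> \<kappa> * X" using C0 L(1) \<kappa> by (auto simp: X_def distrib_left add_nonneg_pos)
    have "norm (integral {-T..T} (\<lambda>t. f t * cis (- (w * t)))) \<le> \<kappa> * (2 * T)"
      if w: "\<bar>w - w0\<bar> < r" and T: "T \<ge> X" for w T
    proof -
      have "norm (integral {-T..-T + 2 * T} (\<lambda>t. f t * cis (- (w * t)))) \<le> \<kappa>/2 * (2 * T) + C * L"
        using T X(1) C by (intro integral_block_bound contw L block[OF w]) (auto simp: norm_mult)
      moreover have "C * L \<le> \<kappa> * T"
        using X(2) mult_left_mono[OF T, of \<kappa>] \<kappa> by linarith
      ultimately show ?thesis by simp
    qed
    then show ?thesis using r X(1) unfolding P_def by blast
  qed
  then obtain r X where rX: "\<And>w0. \<bar>w0\<bar> \<le> d \<Longrightarrow> r w0 > 0 \<and> X w0 > 0 \<and> P w0 (r w0) (X w0)"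
    by metis
  have "w \<in> ball w (r w)" if "w \<in> {-d..d}" for w using rX[of w] that by (simp add: abs_le_iff)
  then have "{-d..d} \<subseteq> (\<Union>w0\<in>{-d..d}. ball w0 (r w0))" by blast
  then obtain D where D: "D \<subseteq> {-d..d}" "finite D" "{-d..d} \<subseteq> (\<Union>w0\<in>D. ball w0 (r w0))"
    by (rule compactE_image[OF compact_Icc open_ball])
  define T0 where "T0 = 1 + (\<Sum>w0\<in>D. X w0)"
  have Xpos: "X w0 > 0" if "w0 \<in> D" for w0 using D(1) that rX[of w0] by (auto simp: abs_le_iff)
  have "norm (integral {-T..T} (\<lambda>t. f t * cis (- (w * t)))) \<le> \<kappa> * (2 * T)" if T: "T \<ge> T0" and w: "\<bar>w\<bar> \<le> d" for T w
  proof -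
    have "w \<in> {-d..d}" using w by auto
    then obtain w0 where w0: "w0 \<in> D" "\<bar>w - w0\<bar> < r w0" using D(3) by (auto simp: dist_real_def)
    have "X w0 \<le> (\<Sum>w0\<in>D. X w0)" using D(2) w0(1) Xpos by (intro member_le_sum) (auto intro: less_imp_le)
    then have "T \<ge> X w0" using T unfolding T0_def by simp
    moreover have "w0 \<in> {-d..d}" using D(1) w0(1) by blast
    ultimately show ?thesis using rX[of w0] w0(2) unfolding P_def by (auto simp: abs_le_iff)
  qed
  moreover have "T0 > 0" unfolding T0_def using Xpos by (intro add_pos_nonneg sum_nonneg) (auto intro: less_imp_le)
  ultimately show ?thesis by blast
qed

lemma increment_eq_integral:
  fixes F f :: "real \<Rightarrow> complex"
  assumes "\<And>t. (F has_vector_derivative f t) (at t)" "a \<le> b"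
  shows "integral {a..b} f = F b - F a"
  by (rule integral_unique, rule fundamental_theorem_of_calculus)
     (use assms in \<open>auto intro: has_vector_derivative_at_within\<close>)

text \<open>
The increment is the integral of f(t + s) over 0 \<le> s \<le> \<tau>. Interchanging the two integrals reduces
its means to those of the translates of f, which vanish uniformly in s.
\<close>

lemma spectral_gap_increment:
  assumes cont: "continuous_on UNIV f" and F: "\<And>t. (F has_vector_derivative f t) (at t)"
    and gap: "spectral_gap f \<delta>" and \<tau>: "\<tau> \<ge> 0"
  shows "spectral_gap (\<lambda>t. F (t + \<tau>) - F t) \<delta>"
  unfolding spectral_gap_def mean_zero_def
proof (intro allI impI)
  fix w \<epsilon> :: real assume w: "\<bar>w\<bar> < \<delta>" and e: "\<epsilon> > 0"
  have "\<epsilon> / (\<tau> + 1) > 0" using e \<tau> by simp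
  then obtain L0 where L0: "L0 > 0"
    "\<And>L a. L\<ge>L0 \<Longrightarrow> norm (integral {a..a+L} (\<lambda>t. f t * cis (- (w * t)))) \<le> \<epsilon> / (\<tau> + 1) * L"
    using gap w unfolding spectral_gap_def mean_zero_def by meson
  have "norm (integral {a..a+L} (\<lambda>t. (F (t + \<tau>) - F t) * cis (- (w * t)))) \<le> \<epsilon> * L" if L: "L \<ge> L0" for L a
  proof -
    have inc: "F (t + \<tau>) - F t = integral {0..\<tau>} (\<lambda>s. f (t + s))" for t
      using increment_eq_integral[OF F, of t "t + \<tau>"] \<tau>
        integral_shift[of 0 t \<tau> f] continuous_on_subset[OF cont]
      by (simp add: o_def add.commute)
    have c2: "continuous_on S (\<lambda>(t, s). f (t + s) * cis (- (w * t)))" for S :: "(real \<times> real) set"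
      unfolding split_beta
      by (intro continuous_intros continuous_on_compose2[OF cont]) auto
    have "integral {a..a+L} (\<lambda>t. (F (t + \<tau>) - F t) * cis (- (w * t)))
        = integral {a..a+L} (\<lambda>t. integral {0..\<tau>} (\<lambda>s. f (t + s) * cis (- (w * t))))"
      by (simp add: inc)
    also have "\<dots> = integral {0..\<tau>} (\<lambda>s. integral {a..a+L} (\<lambda>t. f (t + s) * cis (- (w * t))))"
      using integral_swap_continuous[OF c2, of a "a+L" 0 \<tau>] by simp
    also have "norm \<dots> \<le> \<epsilon> / (\<tau> + 1) * L * (\<tau> - 0)"
    proof (rule integral_bound)
      have "continuous_on (cbox 0 \<tau>) (\<lambda>s. integral (cbox a (a+L)) (\<lambda>t. f (t + s) * cis (- (w * t))))"
        by (rule integral_continuous_on_param)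
          (auto simp: split_beta intro!: continuous_intros continuous_on_compose2[OF cont])
      then show "continuous_on {0..\<tau>} (\<lambda>s. integral {a..a+L} (\<lambda>t. f (t + s) * cis (- (w * t))))" by simp
      fix s
      have "integral {a..a+L} (\<lambda>t. f (t + s) * cis (- (w * t)))
          = integral {a..a+L} (\<lambda>t. cis (w * s) * (f (t + s) * cis (- (w * (t + s)))))"
        by (intro integral_cong) (simp add: cis_mult algebra_simps)
      also have "\<dots> = cis (w * s) * integral {a..a+L} (\<lambda>t. f (t + s) * cis (- (w * (t + s))))" by simp
      also have "integral {a..a+L} (\<lambda>t. f (t + s) * cis (- (w * (t + s))))
          = integral {a+s..a+s+L} (\<lambda>t. f t * cis (- (w * t)))"
        using integral_shift[of a s "a+L" "\<lambda>t. f t * cis (- (w * t))"] continuous_on_subset[OF cont]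
        by (simp add: o_def continuous_intros add_ac)
      finally have "norm (integral {a..a+L} (\<lambda>t. f (t + s) * cis (- (w * t))))
          = norm (integral {a+s..a+s+L} (\<lambda>t. f t * cis (- (w * t))))" by (simp add: norm_mult)
      then show "norm (integral {a..a+L} (\<lambda>t. f (t + s) * cis (- (w * t)))) \<le> \<epsilon> / (\<tau> + 1) * L"
        using L0(2)[OF L, of "a+s"] by simp
    qed (use \<tau> in auto)
    also have "\<dots> \<le> \<epsilon> * L"
    proof -
      have "\<tau> / (\<tau> + 1) \<le> 1" using \<tau> by simp
      then have "(\<epsilon> * L) * (\<tau> / (\<tau> + 1)) \<le> (\<epsilon> * L) * 1" using e L L0(1) by (intro mult_left_mono) auto
      then show ?thesis by (simp add: mult_ac)
    qed
    finally show ?thesis .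
  qed
  then show "\<exists>L0>0. \<forall>L\<ge>L0. \<forall>a. norm (integral {a..a+L} (\<lambda>t. (F (t + \<tau>) - F t) * cis (- (w * t)))) \<le> \<epsilon> * L"
    using L0(1) by blast
qed

section \<open>Trigonometric polynomials of period 2 T\<close>

definition harmonic :: "real \<Rightarrow> int \<Rightarrow> real \<Rightarrow> complex" where
  "harmonic T m t = cis (pi / T * of_int m * t)"

lemma continuous_on_harmonic [continuous_intros]:
  "continuous_on A f \<Longrightarrow> continuous_on A (\<lambda>t. harmonic T m (f t))"
  unfolding harmonic_def by (intro continuous_intros)

lemma norm_harmonic [simp]: "norm (harmonic T m t) = 1"
  by (simp add: harmonic_def)

lemma harmonic_0 [simp]: "harmonic T 0 t = 1" "harmonic T m 0 = 1"
  by (simp_all add: harmonic_def)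

lemma harmonic_mult: "harmonic T m t * harmonic T n t = harmonic T (m + n) t"
  by (simp add: harmonic_def cis_mult algebra_simps)

lemma harmonic_add: "harmonic T m (s + t) = harmonic T m s * harmonic T m t"
  by (simp add: harmonic_def cis_mult distrib_left add_divide_distrib)

lemma cnj_harmonic: "cnj (harmonic T m t) = harmonic T (- m) t"
  by (simp add: harmonic_def cis_cnj)

lemma harmonic_minus: "harmonic T m (- t) = harmonic T (- m) t"
  by (simp add: harmonic_def)

lemma harmonic_periodic:
  assumes "T > 0"
  shows "harmonic T m (t + 2 * T) = harmonic T m t"
proof -
  have "pi / T * of_int m * (t + 2 * T) = pi / T * of_int m * t + 2 * pi * of_int m"
    using assms by (simp add: field_simps)
  then show ?thesis unfolding harmonic_def by (simp add: cis_mult[symmetric])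
qed

lemma integral_harmonic:
  assumes T: "T > 0"
  shows "integral {-T..T} (harmonic T m) = (if m = 0 then of_real (2 * T) else 0)"
proof (cases "m = 0")
  case True
  then have "harmonic T m = (\<lambda>t. 1)" by (simp add: fun_eq_iff)
  then show ?thesis using True T by (simp add: scaleR_conv_of_real)
next
  case False
  define w where "w = pi / T * of_int m"
  have w: "w \<noteq> 0" using False T by (simp add: w_def)
  have h: "harmonic T m t = cis (w * t)" for t by (simp add: harmonic_def w_def)
  have "((\<lambda>t. cis (w * t) / (\<i> * of_real w)) has_vector_derivative harmonic T m t) (at t within {-T..T})" for t
    unfolding has_vector_derivative_def
    by (rule derivative_eq_intros refl | simp add: w)+
       (auto simp: fun_eq_iff h scaleR_conv_of_real w complex_eq_iff)
  then have "(harmonic T m has_integral cis (w * T) / (\<i> * of_real w) - cis (w * (-T)) / (\<i> * of_real w)) {-T..T}"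
    using T by (intro fundamental_theorem_of_calculus) auto
  moreover have "cis (w * T) = cis (w * (-T))"
    using harmonic_periodic[OF T, of m "-T"] by (simp add: harmonic_def w_def)
  ultimately show ?thesis using False by (simp add: integral_unique)
qed

definition trig_poly :: "real \<Rightarrow> int set \<Rightarrow> (int \<Rightarrow> complex) \<Rightarrow> real \<Rightarrow> complex" where
  "trig_poly T I c t = (\<Sum>m\<in>I. c m * harmonic T m t)"

lemma continuous_on_trig_poly [continuous_intros]:
  "continuous_on A f \<Longrightarrow> continuous_on A (\<lambda>t. trig_poly T I c (f t))"
  unfolding trig_poly_def by (intro continuous_intros)

lemma integral_trig_poly_mult_cnj:
  assumes T: "T > 0" and I: "finite I"
  shows "integral {-T..T} (\<lambda>t. trig_poly T I c t * cnj (trig_poly T I d t))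
    = of_real (2 * T) * (\<Sum>m\<in>I. c m * cnj (d m))"
proof -
  have "trig_poly T I c t * cnj (trig_poly T I d t)
      = (\<Sum>m\<in>I. \<Sum>n\<in>I. (c m * cnj (d n)) * harmonic T (m - n) t)" for t
    by (simp add: trig_poly_def sum_product cnj_harmonic)
       (intro sum.cong refl, simp add: mult_ac, simp add: mult.assoc[symmetric] harmonic_mult)
  then have "integral {-T..T} (\<lambda>t. trig_poly T I c t * cnj (trig_poly T I d t))
      = (\<Sum>m\<in>I. \<Sum>n\<in>I. (c m * cnj (d n)) * integral {-T..T} (harmonic T (m - n)))"
    using I by (simp add: integral_sum integrable_sum continuous_integrable continuous_intros)
  also have "\<dots> = (\<Sum>m\<in>I. \<Sum>n\<in>I. if n = m then of_real (2 * T) * (c m * cnj (d m)) else 0)"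
    by (intro sum.cong refl) (auto simp: integral_harmonic[OF T])
  also have "\<dots> = (\<Sum>m\<in>I. of_real (2 * T) * (c m * cnj (d m)))"
    using I by (simp add: sum.delta)
  finally show ?thesis by (simp add: sum_distrib_left)
qed

lemma parseval_trig_poly:
  assumes T: "T > 0" and I: "finite I"
  shows "integral {-T..T} (\<lambda>t. (norm (trig_poly T I c t))\<^sup>2) = 2 * T * (\<Sum>m\<in>I. (norm (c m))\<^sup>2)"
proof -
  have "(\<lambda>t. (norm (trig_poly T I c t))\<^sup>2) integrable_on {-T..T}"
    by (intro integrable_continuous_real continuous_intros)
  then have "((\<lambda>t. of_real ((norm (trig_poly T I c t))\<^sup>2)) has_integral
      complex_of_real (integral {-T..T} (\<lambda>t. (norm (trig_poly T I c t))\<^sup>2))) {-T..T}"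
    by (intro has_integral_of_real integrable_integral)
  then have "complex_of_real (integral {-T..T} (\<lambda>t. (norm (trig_poly T I c t))\<^sup>2))
      = integral {-T..T} (\<lambda>t. trig_poly T I c t * cnj (trig_poly T I c t))"
    by (simp only: complex_norm_square integral_unique)
  also have "\<dots> = complex_of_real (2 * T * (\<Sum>m\<in>I. (norm (c m))\<^sup>2))"
    by (subst integral_trig_poly_mult_cnj[OF T I]) (simp only: complex_norm_square[symmetric] of_real_sum of_real_mult)
  finally show ?thesis by (simp only: of_real_eq_iff)
qed

text \<open>
Translation by x multiplies the coefficient of order m by a phase, so the correlation of the translate
with the original has the coefficients |c m|^2.
\<close>

lemma autocorrelation_trig_poly:
  assumes T: "T > 0" and I: "finite I"
  shows "integral {-T..T} (\<lambda>t. trig_poly T I c (t + x) * cnj (trig_poly T I c t))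
    = of_real (2 * T) * trig_poly T I (\<lambda>m. of_real ((norm (c m))\<^sup>2)) x"
proof -
  have "trig_poly T I c (t + x) = trig_poly T I (\<lambda>m. c m * harmonic T m x) t" for t
    by (simp add: trig_poly_def harmonic_add mult_ac)
  then show ?thesis
    using integral_trig_poly_mult_cnj[OF T I, of "\<lambda>m. c m * harmonic T m x" c]
    by (simp add: trig_poly_def complex_norm_square mult_ac del: of_real_power)
qed

lemma integral_trig_poly_mult_harmonic:
  assumes T: "T > 0" and I: "finite I" "n \<in> I"
  shows "integral {-T..T} (\<lambda>t. trig_poly T I c t * harmonic T (- n) t) = of_real (2 * T) * c n"
proof -
  have "harmonic T (- n) t = cnj (trig_poly T I (\<lambda>m. if m = n then 1 else 0) t)" for t
    using I by (simp add: trig_poly_def cnj_harmonic if_distrib[of "\<lambda>x. x * _"] sum.delta cong: if_cong)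
  then show ?thesis
    using integral_trig_poly_mult_cnj[OF T I(1), of c "\<lambda>m. if m = n then 1 else 0"] I
    by (simp add: if_distrib[of cnj] if_distrib[of "(*) _"] sum.delta cong: if_cong)
qed

section \<open>The Fejer-Korovkin kernel\<close>

text \<open>
The kernel is the squared modulus of the sum of \<open>fk_weight n j\<close> exp(ij\<theta>), normalized to mean 1.
The sine weights form the top eigenvector of the path with n vertices; with them the kernel has the largest
first Fourier coefficient among all nonnegative trigonometric polynomials of degree below n with mean 1. The resulting
value cos(\<pi>/(n+1)) differs from 1 by O(1/n^2), whereas the Fejer kernel only gives 1/n.
\<close>

definition fk_weight :: "nat \<Rightarrow> int \<Rightarrow> real" where
  "fk_weight n j = sin (pi * of_int j / (real n + 1))"

definition fk_mass :: "nat \<Rightarrow> real" where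
  "fk_mass n = (\<Sum>j\<in>{1..int n}. (fk_weight n j)\<^sup>2)"

definition fk_coeff :: "nat \<Rightarrow> int \<Rightarrow> real" where
  "fk_coeff n m = (\<Sum>j\<in>{1..int n}.
     if j + m \<in> {1..int n} then fk_weight n (j + m) * fk_weight n j else 0) / fk_mass n"

definition fk_kernel :: "real \<Rightarrow> nat \<Rightarrow> real \<Rightarrow> real" where
  "fk_kernel T n t = (norm (\<Sum>j\<in>{1..int n}. of_real (fk_weight n j) * harmonic T j t))\<^sup>2 / fk_mass n"

lemma fk_mass_pos:
  assumes "n \<ge> 1"
  shows "fk_mass n > 0"
proof -
  have "0 < pi / (real n + 1)" "pi / (real n + 1) < pi" using assms by (auto simp: divide_simps)
  then have "(fk_weight n 1)\<^sup>2 > 0" unfolding fk_weight_def by (simp add: sin_gt_zero less_imp_neq[symmetric])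
  also have "(fk_weight n 1)\<^sup>2 \<le> fk_mass n"
    unfolding fk_mass_def using assms by (intro member_le_sum) auto
  finally show ?thesis .
qed

lemma fk_kernel_nonneg: "fk_kernel T n t \<ge> 0"
  by (simp add: fk_kernel_def fk_mass_def sum_nonneg)

lemma continuous_on_fk_kernel [continuous_intros]:
  "continuous_on A f \<Longrightarrow> continuous_on A (\<lambda>t. fk_kernel T n (f t))"
  unfolding fk_kernel_def divide_inverse by (intro continuous_intros)

lemma fk_kernel_periodic: "T > 0 \<Longrightarrow> fk_kernel T n (t + 2 * T) = fk_kernel T n t"
  by (simp add: fk_kernel_def harmonic_periodic)

lemma fk_kernel_expand:
  "complex_of_real (fk_kernel T n t) = trig_poly T {-int n..int n} (\<lambda>m. of_real (fk_coeff n m)) t"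
proof -
  let ?A = "{1..int n}" and ?I = "{-int n..int n}" and ?a = "fk_weight n"
  have "complex_of_real ((norm (\<Sum>j\<in>?A. of_real (?a j) * harmonic T j t))\<^sup>2)
      = (\<Sum>k\<in>?A. of_real (?a k) * harmonic T k t) * (\<Sum>j\<in>?A. of_real (?a j) * harmonic T (- j) t)"
    by (simp only: complex_norm_square cnj_sum complex_cnj_mult complex_cnj_complex_of_real cnj_harmonic)
  also have "\<dots> = (\<Sum>j\<in>?A. \<Sum>k\<in>?A. of_real (?a k * ?a j) * harmonic T (k - j) t)"
    unfolding sum_product by (subst sum.swap)
      (intro sum.cong refl, simp add: mult_ac, simp add: mult.assoc[symmetric] harmonic_mult)
  also have "\<dots> = (\<Sum>j\<in>?A. \<Sum>m\<in>?I. (if j + m \<in> ?A then of_real (?a (j + m) * ?a j) else 0) * harmonic T m t)"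
  proof (rule sum.cong[OF refl])
    \<comment> \<open>Substitute k = j + m; the terms with j + m outside the range of summation vanish.\<close>
    fix j assume j: "j \<in> ?A"
    have fin: "finite {m\<in>?I. j + m \<notin> ?A}" by (rule finite_subset[of _ ?I]) auto
    show "(\<Sum>k\<in>?A. of_real (?a k * ?a j) * harmonic T (k - j) t)
        = (\<Sum>m\<in>?I. (if j + m \<in> ?A then of_real (?a (j + m) * ?a j) else 0) * harmonic T m t)"
      using j fin
      by (intro sum.reindex_bij_witness_not_neutral[of "{}" "{m\<in>?I. j + m \<notin> ?A}" _ "\<lambda>m. j + m" "\<lambda>k. k - j"]) auto
  qed
  also have "\<dots> = (\<Sum>m\<in>?I. \<Sum>j\<in>?A. (if j + m \<in> ?A then of_real (?a (j + m) * ?a j) else 0) * harmonic T m t)"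
    by (rule sum.swap)
  also have "\<dots> = (\<Sum>m\<in>?I. of_real (\<Sum>j\<in>?A. if j + m \<in> ?A then ?a (j + m) * ?a j else 0) * harmonic T m t)"
    unfolding sum_distrib_right[symmetric] of_real_sum by (intro sum.cong refl arg_cong2[of _ _ _ _ "(*)"]) auto
  finally show ?thesis
    unfolding fk_kernel_def trig_poly_def fk_coeff_def
    by (simp only: of_real_divide times_divide_eq_left) (simp only: sum_divide_distrib)
qed

lemma fk_coeff_0: "n \<ge> 1 \<Longrightarrow> fk_coeff n 0 = 1"
  using fk_mass_pos[of n] by (simp add: fk_coeff_def fk_mass_def power2_eq_square)

text \<open>
The weights vanish at the end points 0 and n + 1, so the sums over neighbouring pairs can be completed, and
a(j+1) + a(j-1) = 2 cos(\<pi>/(n+1)) a(j).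
\<close>

lemma fk_coeff_1:
  assumes n: "n \<ge> 1"
  shows "fk_coeff n 1 + fk_coeff n (-1) = 2 * cos (pi / (real n + 1))"
proof -
  let ?A = "{1..int n}" and ?a = "fk_weight n"
  have end0: "?a 0 = 0" by (simp add: fk_weight_def)
  have "pi * of_int (int n + 1) / (real n + 1) = pi" by (simp add: field_simps)
  then have end1: "?a (int n + 1) = 0" unfolding fk_weight_def by simp
  have "(\<Sum>j\<in>?A. if j + 1 \<in> ?A then ?a (j + 1) * ?a j else 0) = (\<Sum>j\<in>?A. ?a (j + 1) * ?a j)"
  proof (intro sum.cong refl)
    fix j assume "j \<in> ?A"
    then have "j + 1 \<in> ?A \<or> j = int n" by auto
    then show "(if j + 1 \<in> ?A then ?a (j + 1) * ?a j else 0) = ?a (j + 1) * ?a j" using end1 by auto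
  qed
  moreover have "(\<Sum>j\<in>?A. if j + -1 \<in> ?A then ?a (j + -1) * ?a j else 0) = (\<Sum>j\<in>?A. ?a (j - 1) * ?a j)"
  proof (intro sum.cong refl)
    fix j assume "j \<in> ?A"
    then have "j + -1 \<in> ?A \<or> j = 1" by auto
    then show "(if j + -1 \<in> ?A then ?a (j + -1) * ?a j else 0) = ?a (j - 1) * ?a j" using end0 by auto
  qed
  ultimately have "fk_coeff n 1 + fk_coeff n (-1) = (\<Sum>j\<in>?A. (?a (j + 1) + ?a (j - 1)) * ?a j) / fk_mass n"
    unfolding fk_coeff_def by (simp add: add_divide_distrib[symmetric] sum.distrib[symmetric] distrib_right)
  also have "(\<Sum>j\<in>?A. (?a (j + 1) + ?a (j - 1)) * ?a j) = 2 * cos (pi / (real n + 1)) * fk_mass n"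
  proof -
    have "?a (j + 1) + ?a (j - 1) = 2 * cos (pi / (real n + 1)) * ?a j" for j
      by (simp add: fk_weight_def distrib_left right_diff_distrib add_divide_distrib diff_divide_distrib sin_add sin_diff)
    then show ?thesis by (simp add: fk_mass_def sum_distrib_left power2_eq_square mult.assoc)
  qed
  finally show ?thesis using fk_mass_pos[OF n] by simp
qed

lemma fk_kernel_even: "fk_kernel T n (- t) = fk_kernel T n t"
proof -
  have "(\<Sum>j\<in>{1..int n}. of_real (fk_weight n j) * harmonic T j (- t))
      = cnj (\<Sum>j\<in>{1..int n}. of_real (fk_weight n j) * harmonic T j t)"
    by (simp add: harmonic_minus cnj_harmonic)
  then show ?thesis unfolding fk_kernel_def by (simp only: complex_mod_cnj)
qed

lemma integral_fk_kernel_mult_harmonic: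
  assumes T: "T > 0" and m: "m \<in> {-int n..int n}"
  shows "integral {-T..T} (\<lambda>t. of_real (fk_kernel T n t) * harmonic T (- m) t) = of_real (2 * T * fk_coeff n m)"
  unfolding fk_kernel_expand using integral_trig_poly_mult_harmonic[OF T _ m] by simp

lemma integral_fk_kernel:
  assumes T: "T > 0" and n: "n \<ge> 1"
  shows "integral {-T..T} (fk_kernel T n) = 2 * T"
proof -
  have "((\<lambda>t. of_real (fk_kernel T n t)) has_integral complex_of_real (integral {-T..T} (fk_kernel T n))) {-T..T}"
    by (intro has_integral_of_real integrable_integral integrable_continuous_real continuous_intros)
  then have "complex_of_real (integral {-T..T} (fk_kernel T n)) = complex_of_real (2 * T)"
    using integral_fk_kernel_mult_harmonic[OF T, of 0 n] fk_coeff_0[OF n] by (simp add: integral_unique)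
  then show ?thesis by (simp only: of_real_eq_iff)
qed

lemma abs_fk_coeff_le_1:
  assumes n: "n \<ge> 1" and m: "m \<in> {-int n..int n}"
  shows "\<bar>fk_coeff n m\<bar> \<le> 1"
proof -
  have "norm (integral {-1..1} (\<lambda>t. of_real (fk_kernel 1 n t) * harmonic 1 (- m) t)) \<le> integral {-1..1} (fk_kernel 1 n)"
    by (intro integral_norm_bound_integral integrable_continuous_interval continuous_intros)
       (auto simp: norm_mult fk_kernel_nonneg)
  then show ?thesis
    unfolding integral_fk_kernel_mult_harmonic[OF zero_less_one m] norm_of_real
    using integral_fk_kernel[OF zero_less_one n] by simp
qed

lemma integral_fk_kernel_one_minus_cos:
  assumes T: "T > 0" and n: "n \<ge> 1"
  shows "integral {-T..T} (\<lambda>t. fk_kernel T n t * (1 - cos (pi / T * t))) = 2 * T * (1 - cos (pi / (real n + 1)))"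
proof -
  have cos: "complex_of_real (cos (pi / T * t)) = (harmonic T (- (1)) t + harmonic T (- (-1)) t) / 2" for t
    by (simp add: harmonic_def complex_eq_iff)
  have int: "(\<lambda>t. of_real (fk_kernel T n t) * harmonic T m t) integrable_on {-T..T}" for m
    by (intro integrable_continuous_interval continuous_intros)
  have int1: "(\<lambda>t. complex_of_real (fk_kernel T n t)) integrable_on {-T..T}"
    by (intro integrable_continuous_interval continuous_intros)
  have "((\<lambda>t. of_real (fk_kernel T n t * (1 - cos (pi / T * t)))) has_integral
      complex_of_real (integral {-T..T} (\<lambda>t. fk_kernel T n t * (1 - cos (pi / T * t))))) {-T..T}"
    by (intro has_integral_of_real integrable_integral integrable_continuous_real continuous_intros)
  then have "complex_of_real (integral {-T..T} (\<lambda>t. fk_kernel T n t * (1 - cos (pi / T * t))))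
      = integral {-T..T} (\<lambda>t. complex_of_real (fk_kernel T n t)
          - (of_real (fk_kernel T n t) * harmonic T (- (1)) t + of_real (fk_kernel T n t) * harmonic T (- (-1)) t) / 2)"
    unfolding of_real_mult of_real_diff cos by (simp add: integral_unique algebra_simps add_divide_distrib)
  also have "\<dots> = integral {-T..T} (\<lambda>t. complex_of_real (fk_kernel T n t))
      - (integral {-T..T} (\<lambda>t. of_real (fk_kernel T n t) * harmonic T (- (1)) t)
        + integral {-T..T} (\<lambda>t. of_real (fk_kernel T n t) * harmonic T (- (-1)) t)) / 2"
    using int int1 by (simp add: integral_diff integral_add integrable_add integrable_diff del: minus_minus)
  also have "\<dots> = of_real (2 * T * fk_coeff n 0) - (of_real (2 * T * fk_coeff n 1) + of_real (2 * T * fk_coeff n (-1))) / 2"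
    using n integral_fk_kernel_mult_harmonic[OF T, of 0 n]
    by (subst (1 2) integral_fk_kernel_mult_harmonic[OF T]) auto
  also have "\<dots> = complex_of_real (2 * T * fk_coeff n 0 - T * (fk_coeff n 1 + fk_coeff n (-1)))"
    by (simp add: field_simps)
  also have "\<dots> = complex_of_real (2 * T * (1 - cos (pi / (real n + 1))))"
    unfolding fk_coeff_1[OF n] fk_coeff_0[OF n] by (simp add: algebra_simps)
  finally show ?thesis by (simp only: of_real_eq_iff)
qed

text \<open>
The sine is concave on [0, \<pi>/2] and so lies above its chord.
\<close>

lemma jordan_inequality:
  assumes "\<bar>x\<bar> \<le> pi / 2"
  shows "2 / pi * \<bar>x\<bar> \<le> \<bar>sin x\<bar>"
proof -
  have conv: "convex_on {0..pi/2} (\<lambda>x. - sin x)"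
  proof (rule f''_ge0_imp_convex)
    show "((\<lambda>x. - sin x) has_real_derivative - cos x) (at x)" for x :: real
      by (auto intro!: derivative_eq_intros)
    show "((\<lambda>x. - cos x) has_real_derivative sin x) (at x)" for x :: real
      by (auto intro!: derivative_eq_intros)
    show "0 \<le> sin x" if "x \<in> {0..pi/2}" for x
      using that pi_gt_zero by (intro sin_ge_zero) auto
  qed auto
  have pos: "2 / pi * y \<le> sin y" if y: "0 \<le> y" "y \<le> pi / 2" for y
  proof -
    have "2 / pi * y \<le> 1" using y pi_gt_zero by (simp add: field_simps)
    then show ?thesis
      using convex_onD[OF conv, of "2 / pi * y" 0 "pi/2"] y pi_gt_zero by simp
  qed
  show ?thesis
    using pos[of "\<bar>x\<bar>"] assms by (cases "x \<ge> 0") auto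
qed

lemma square_le_one_minus_cos:
  assumes T: "T > 0" and t: "\<bar>t\<bar> \<le> T"
  shows "t\<^sup>2 \<le> T\<^sup>2 / 2 * (1 - cos (pi / T * t))"
proof -
  define x where "x = pi / T * t / 2"
  have "\<bar>x\<bar> = pi / 2 * (\<bar>t\<bar> / T)" using T by (simp add: x_def abs_mult)
  also have "\<dots> \<le> pi / 2 * 1" using t T by (intro mult_left_mono) auto
  finally have "2 / pi * \<bar>x\<bar> \<le> \<bar>sin x\<bar>" by (intro jordan_inequality) simp
  moreover have "2 / pi * \<bar>x\<bar> = \<bar>t\<bar> / T" using T by (simp add: x_def abs_mult)
  ultimately have "\<bar>t\<bar> / T \<le> \<bar>sin x\<bar>" by linarith
  then have "\<bar>t\<bar> \<le> T * \<bar>sin x\<bar>" using T by (simp add: pos_divide_le_eq mult.commute)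
  then have "t\<^sup>2 \<le> (T * \<bar>sin x\<bar>)\<^sup>2" by (metis abs_ge_zero power2_abs power_mono)
  moreover have "cos (pi / T * t) = 1 - 2 * (sin x)\<^sup>2" using cos_double_sin[of x] by (simp add: x_def)
  ultimately show ?thesis by (simp add: power_mult_distrib)
qed

lemma one_minus_cos_le: "1 - cos x \<le> x\<^sup>2 / 2" for x :: real
proof -
  have "cos x = 1 - 2 * (sin (x/2))\<^sup>2" using cos_double_sin[of "x/2"] by simp
  moreover have "(sin (x/2))\<^sup>2 \<le> (x/2)\<^sup>2"
    using abs_sin_x_le_abs_x[of "x/2"] by (metis abs_ge_zero power2_abs power_mono)
  ultimately show ?thesis by (simp add: power2_eq_square)
qed

text \<open>
Here |t| \<le> 1/2 + t^2/2, and t^2 is dominated by a multiple of 1 - cos(\<pi>t/T), whose mean against the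
kernel is known exactly. With n of order \<delta> T the bound does not depend on T.
\<close>

lemma fk_kernel_first_moment:
  assumes T: "T > 0" and n: "n \<ge> 1"
  shows "integral {-T..T} (\<lambda>t. fk_kernel T n t * \<bar>t\<bar>) \<le> 2 * T * (1/2 + T\<^sup>2 * pi\<^sup>2 / (8 * (real n + 1)\<^sup>2))"
proof -
  have "integral {-T..T} (\<lambda>t. fk_kernel T n t * \<bar>t\<bar>)
      \<le> integral {-T..T} (\<lambda>t. fk_kernel T n t * (1/2) + T\<^sup>2/4 * (fk_kernel T n t * (1 - cos (pi / T * t))))"
  proof (intro integral_le integrable_continuous_real continuous_intros)
    fix t assume t: "t \<in> {-T..T}"
    have "\<bar>t\<bar> \<le> 1/2 + t\<^sup>2 / 2" using zero_le_power2[of "\<bar>t\<bar> - 1"] by (simp add: power2_eq_square algebra_simps)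
    also have "\<bar>t\<bar> \<le> T" using t by auto
    from square_le_one_minus_cos[OF T this]
    have "1/2 + t\<^sup>2 / 2 \<le> 1/2 + T\<^sup>2/4 * (1 - cos (pi / T * t))" by simp
    finally have "fk_kernel T n t * \<bar>t\<bar> \<le> fk_kernel T n t * (1/2 + T\<^sup>2/4 * (1 - cos (pi / T * t)))"
      by (rule mult_left_mono[OF _ fk_kernel_nonneg])
    then show "fk_kernel T n t * \<bar>t\<bar> \<le> fk_kernel T n t * (1/2) + T\<^sup>2/4 * (fk_kernel T n t * (1 - cos (pi / T * t)))"
      by (simp only: distrib_left mult.left_commute)
  qed
  also have "\<dots> = integral {-T..T} (\<lambda>t. fk_kernel T n t * (1/2)) + integral {-T..T} (\<lambda>t. T\<^sup>2/4 * (fk_kernel T n t * (1 - cos (pi / T * t))))"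
    by (intro integral_add integrable_continuous_real continuous_intros)
  also have "\<dots> = 2 * T * (1/2 + T\<^sup>2/4 * (1 - cos (pi / (real n + 1))))"
    unfolding integral_mult_left integral_mult_right integral_fk_kernel[OF T n] integral_fk_kernel_one_minus_cos[OF T n]
    by (simp add: field_simps)
  also have "\<dots> \<le> 2 * T * (1/2 + T\<^sup>2/4 * ((pi / (real n + 1))\<^sup>2 / 2))"
    using T by (intro mult_left_mono add_left_mono one_minus_cos_le) auto
  finally show ?thesis by (simp add: power_divide)
qed

section \<open>Kernel averages of an almost periodic function\<close>

text \<open>
The convolution on the circle of length 2 T of the kernel with the restriction of z to [-T, T].
\<close>

definition fk_mean :: "(real \<Rightarrow> complex) \<Rightarrow> real \<Rightarrow> nat \<Rightarrow> real \<Rightarrow> complex" where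
  "fk_mean z T n x = integral {-T..T} (\<lambda>t. z t * of_real (fk_kernel T n (x - t))) / of_real (2 * T)"

definition window_coeff :: "(real \<Rightarrow> complex) \<Rightarrow> real \<Rightarrow> int \<Rightarrow> complex" where
  "window_coeff z T m = integral {-T..T} (\<lambda>t. z t * harmonic T (- m) t) / of_real (2 * T)"

text \<open>
Convolution multiplies Fourier coefficients: the average has no frequencies outside those of the kernel,
and its coefficients are dominated by the window means of z because |fk_coeff n m| \<le> 1.
\<close>

lemma fk_mean_eq_trig_poly:
  assumes z: "continuous_on UNIV z"
  shows "fk_mean z T n x = trig_poly T {-int n..int n} (\<lambda>m. of_real (fk_coeff n m) * window_coeff z T m) x"
proof -
  let ?I = "{-int n..int n}"
  have "z t * of_real (fk_kernel T n (x - t))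
      = (\<Sum>m\<in>?I. (of_real (fk_coeff n m) * harmonic T m x) * (z t * harmonic T (- m) t))" for t
    unfolding fk_kernel_expand trig_poly_def diff_conv_add_uminus harmonic_add
    by (simp add: sum_distrib_left harmonic_minus mult_ac)
  then have "integral {-T..T} (\<lambda>t. z t * of_real (fk_kernel T n (x - t)))
      = (\<Sum>m\<in>?I. (of_real (fk_coeff n m) * harmonic T m x) * integral {-T..T} (\<lambda>t. z t * harmonic T (- m) t))"
    using z by (simp add: integral_sum continuous_integrable continuous_intros)
  then show ?thesis
    unfolding fk_mean_def trig_poly_def window_coeff_def by (simp add: sum_divide_distrib mult_ac)
qed

lemma integral_fk_kernel_shifted:
  assumes T: "T > 0" and n: "n \<ge> 1"
  shows "integral {-T..T} (\<lambda>t. fk_kernel T n (x - t)) = 2 * T"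
proof -
  have "window_coeff (\<lambda>t. 1) T m = (if m = 0 then 1 else 0)" for m
    using integral_harmonic[OF T, of "-m"] T by (simp add: window_coeff_def)
  then have "fk_mean (\<lambda>t. 1) T n x = 1"
    using fk_coeff_0[OF n]
    by (simp add: fk_mean_eq_trig_poly trig_poly_def if_distrib[of "\<lambda>y. _ * y"] if_distrib[of "\<lambda>y. y * _"] cong: if_cong)
  moreover have "((\<lambda>t. of_real (fk_kernel T n (x - t))) has_integral
      complex_of_real (integral {-T..T} (\<lambda>t. fk_kernel T n (x - t)))) {-T..T}"
    by (intro has_integral_of_real integrable_integral integrable_continuous_real continuous_intros)
  ultimately have "complex_of_real (integral {-T..T} (\<lambda>t. fk_kernel T n (x - t))) = of_real (2 * T)"
    using T by (simp add: fk_mean_def integral_unique field_simps)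
  then show ?thesis by (simp only: of_real_eq_iff)
qed

text \<open>
The kernel is nonnegative with integral 2 T over a period, so averaging against it is a contraction for
the supremum norm, also when only a part of the window is used.
\<close>

lemma norm_fk_integral_le:
  fixes y :: "real \<Rightarrow> complex"
  assumes T: "T > 0" and n: "n \<ge> 1" and y: "continuous_on UNIV y" and B: "\<And>t. norm (y t) \<le> B"
    and ab: "-T \<le> a" "b \<le> T"
  shows "norm (integral {a..b} (\<lambda>t. y t * of_real (fk_kernel T n (x - t)))) \<le> B * (2 * T)"
proof -
  have B0: "B \<ge> 0" using B[of 0] norm_ge_zero order_trans by blast
  have "norm (integral {a..b} (\<lambda>t. y t * of_real (fk_kernel T n (x - t)))) \<le> integral {a..b} (\<lambda>t. B * fk_kernel T n (x - t))"
    using B by (intro integral_norm_bound_integral continuous_integrable integrable_continuous_real continuous_intros y)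
      (auto simp: norm_mult fk_kernel_nonneg intro!: mult_right_mono)
  also have "\<dots> \<le> integral {-T..T} (\<lambda>t. B * fk_kernel T n (x - t))"
    using ab B0 by (intro integral_subset_le integrable_continuous_real continuous_intros) (auto simp: fk_kernel_nonneg)
  also have "\<dots> = B * (2 * T)"
    using integral_fk_kernel_shifted[OF T n, of x] by simp
  finally show ?thesis .
qed

lemma norm_fk_mean_le:
  assumes T: "T > 0" and n: "n \<ge> 1" and z: "continuous_on UNIV z" and C: "\<And>t. norm (z t) \<le> C"
  shows "norm (fk_mean z T n x) \<le> C"
  using norm_fk_integral_le[OF T n z C, of "-T" T x] T
  by (simp add: fk_mean_def norm_divide norm_mult divide_le_eq)

text \<open>
Shifting x by \<tau> means shifting the window by \<tau> and translating z by \<tau>. The kernel has period 2 T,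
and 2 T is an almost period of z, so the shifted window gives nearly the same integral as the original
one; the translation costs \<epsilon> because \<tau> is an almost period.
\<close>

lemma fk_mean_almost_period:
  assumes T: "T > 0" and n: "n \<ge> 1" and z: "continuous_on UNIV z"
    and \<tau>: "\<tau> \<in> almost_periods z \<epsilon>" "0 \<le> \<tau>" "\<tau> \<le> 2 * T" and per: "2 * T \<in> almost_periods z \<epsilon>"
  shows "norm (fk_mean z T n (x + \<tau>) - fk_mean z T n x) \<le> 2 * \<epsilon>"
proof -
  define p where "p t = z t * of_real (fk_kernel T n (x + \<tau> - t))" for t
  have p: "continuous_on UNIV p" unfolding p_def by (intro continuous_intros z)
  have "integral {-T..T} p + integral {T..T+\<tau>} p = integral {-T..-T+\<tau>} p + integral {-T+\<tau>..T+\<tau>} p"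
    using \<tau> T integral_split[OF p, of "-T" T "T+\<tau>"] integral_split[OF p, of "-T" "-T+\<tau>" "T+\<tau>"] by simp
  moreover have "integral {T..T+\<tau>} p = integral {-T..-T+\<tau>} (\<lambda>t. p (t + 2 * T))"
    using integral_shift[of "-T" "2 * T" "-T+\<tau>" p] continuous_on_subset[OF p]
    by (simp add: o_def add.commute)
  moreover have "integral {-T..-T+\<tau>} p - integral {-T..-T+\<tau>} (\<lambda>t. p (t + 2 * T))
      = integral {-T..-T+\<tau>} (\<lambda>t. p t - p (t + 2 * T))"
    by (intro integral_diff[symmetric] continuous_integrable p continuous_shift)
  ultimately have 1: "integral {-T..T} p - integral {-T+\<tau>..T+\<tau>} p = integral {-T..-T+\<tau>} (\<lambda>t. p t - p (t + 2 * T))"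
    by (simp add: algebra_simps)
  have "p t - p (t + 2 * T) = (z t - z (t + 2 * T)) * of_real (fk_kernel T n (x + \<tau> - t))" for t
    using fk_kernel_periodic[OF T, of n "x + \<tau> - (t + 2 * T)"] by (simp add: p_def algebra_simps)
  then have 2: "norm (integral {-T..T} p - integral {-T+\<tau>..T+\<tau>} p) \<le> \<epsilon> * (2 * T)"
    unfolding 1 using \<tau> almost_periodsD[OF per]
    by (simp only:) (intro norm_fk_integral_le T n continuous_intros z continuous_shift,
        auto simp: norm_minus_commute intro: less_imp_le)
  have "integral {-T+\<tau>..T+\<tau>} p = integral {-T..T} (\<lambda>t. z (t + \<tau>) * of_real (fk_kernel T n (x - t)))"
    using integral_shift[of "-T" \<tau> T p] continuous_on_subset[OF p] by (simp add: o_def p_def)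
  then have "integral {-T+\<tau>..T+\<tau>} p - integral {-T..T} (\<lambda>t. z t * of_real (fk_kernel T n (x - t)))
      = integral {-T..T} (\<lambda>t. (z (t + \<tau>) - z t) * of_real (fk_kernel T n (x - t)))"
    unfolding left_diff_distrib
    by (simp only:) (intro integral_diff[symmetric] continuous_integrable continuous_intros z continuous_shift)
  moreover have "norm (integral {-T..T} (\<lambda>t. (z (t + \<tau>) - z t) * of_real (fk_kernel T n (x - t)))) \<le> \<epsilon> * (2 * T)"
    using almost_periodsD[OF \<tau>(1)] by (intro norm_fk_integral_le T n continuous_intros z continuous_shift) (auto intro: less_imp_le)
  ultimately have 3: "norm (integral {-T+\<tau>..T+\<tau>} p - integral {-T..T} (\<lambda>t. z t * of_real (fk_kernel T n (x - t)))) \<le> \<epsilon> * (2 * T)"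
    by (simp only:)
  from norm_diff_triangle_le[OF 2 3]
  have "norm (integral {-T..T} p - integral {-T..T} (\<lambda>t. z t * of_real (fk_kernel T n (x - t)))) \<le> \<epsilon> * (2 * T) + \<epsilon> * (2 * T)" .
  moreover have "fk_mean z T n (x + \<tau>) - fk_mean z T n x
      = (integral {-T..T} p - integral {-T..T} (\<lambda>t. z t * of_real (fk_kernel T n (x - t)))) / of_real (2 * T)"
    by (simp add: fk_mean_def p_def[abs_def] diff_divide_distrib)
  ultimately show ?thesis using T by (simp add: norm_divide norm_mult divide_le_eq mult_ac)
qed

lemma fk_mean_approx:
  assumes T: "T > 0" and n: "n \<ge> 1" and z: "continuous_on UNIV z"
    and M: "\<And>s t. norm (z s - z t) \<le> M * \<bar>s - t\<bar>"
  shows "norm (fk_mean z T n 0 - z 0) \<le> M * (1/2 + T\<^sup>2 * pi\<^sup>2 / (8 * (real n + 1)\<^sup>2))"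
proof -
  have M0: "M \<ge> 0" using order_trans[OF norm_ge_zero M[of 1 0]] by simp
  have "((\<lambda>t. of_real (fk_kernel T n t)) has_integral complex_of_real (integral {-T..T} (fk_kernel T n))) {-T..T}"
    by (intro has_integral_of_real integrable_integral integrable_continuous_real continuous_intros)
  then have "integral {-T..T} (\<lambda>t. complex_of_real (fk_kernel T n t)) = of_real (2 * T)"
    unfolding integral_fk_kernel[OF T n] by (rule integral_unique)
  then have "integral {-T..T} (\<lambda>t. z 0 * complex_of_real (fk_kernel T n t)) = z 0 * of_real (2 * T)" by simp
  then have "integral {-T..T} (\<lambda>t. z t * of_real (fk_kernel T n t)) - z 0 * of_real (2 * T)
      = integral {-T..T} (\<lambda>t. z t * of_real (fk_kernel T n t) - z 0 * of_real (fk_kernel T n t))"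
    by (subst integral_diff) (auto intro!: continuous_integrable continuous_intros z)
  also have "norm \<dots> \<le> integral {-T..T} (\<lambda>t. M * (fk_kernel T n t * \<bar>t\<bar>))"
  proof (intro integral_norm_bound_integral continuous_integrable integrable_continuous_real continuous_intros z)
    fix t
    have "norm (z t * of_real (fk_kernel T n t) - z 0 * of_real (fk_kernel T n t)) = norm (z t - z 0) * fk_kernel T n t"
      unfolding left_diff_distrib[symmetric] by (simp add: norm_mult fk_kernel_nonneg)
    also have "\<dots> \<le> (M * \<bar>t - 0\<bar>) * fk_kernel T n t" by (intro mult_right_mono M fk_kernel_nonneg)
    finally show "norm (z t * of_real (fk_kernel T n t) - z 0 * of_real (fk_kernel T n t)) \<le> M * (fk_kernel T n t * \<bar>t\<bar>)"
      by (simp add: mult_ac)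
  qed
  also have "\<dots> = M * integral {-T..T} (\<lambda>t. fk_kernel T n t * \<bar>t\<bar>)" by simp
  also have "\<dots> \<le> M * (2 * T * (1/2 + T\<^sup>2 * pi\<^sup>2 / (8 * (real n + 1)\<^sup>2)))"
    using M0 by (intro mult_left_mono fk_kernel_first_moment T n)
  finally have "norm (integral {-T..T} (\<lambda>t. z t * of_real (fk_kernel T n t)) - z 0 * of_real (2 * T))
      \<le> M * (1/2 + T\<^sup>2 * pi\<^sup>2 / (8 * (real n + 1)\<^sup>2)) * (2 * T)" by (simp only: mult_ac)
  moreover have "fk_mean z T n 0 - z 0 = (integral {-T..T} (\<lambda>t. z t * of_real (fk_kernel T n t)) - z 0 * of_real (2 * T)) / of_real (2 * T)"
    using T by (simp add: fk_mean_def fk_kernel_even diff_divide_distrib)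
  ultimately show ?thesis using T by (simp add: norm_divide norm_mult pos_divide_le_eq)
qed

text \<open>
If every interval of length L contains a piece of length \<eta> on which G \<ge> m, then the average of G is at
least a fixed multiple of \<eta> m / L. At least T / (2 L) intervals of length L with disjoint interiors fit
into [0, T].
\<close>

lemma integral_ge_density:
  fixes G :: "real \<Rightarrow> real"
  assumes G: "continuous_on UNIV G" and G0: "\<And>x. G x \<ge> 0" and L: "L > 0" "L \<le> T" and \<eta>: "\<eta> \<ge> 0" "m \<ge> 0"
    and dense: "\<And>s. 0 \<le> s \<Longrightarrow> s + L \<le> T \<Longrightarrow> \<exists>\<tau>. s \<le> \<tau> \<and> \<tau> + \<eta> \<le> s + L \<and> (\<forall>x\<in>{\<tau>..\<tau>+\<eta>}. m \<le> G x)"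
  shows "integral {-T..T} G \<ge> 2 * T * (\<eta> * m / (4 * L))"
proof -
  have int: "G integrable_on {a..b}" for a b
    by (intro integrable_continuous_real continuous_on_subset[OF G]) auto
  have step: "integral {s..s+L} G \<ge> \<eta> * m" if s: "0 \<le> s" "s + L \<le> T" for s
  proof -
    obtain \<tau> where \<tau>: "s \<le> \<tau>" "\<tau> + \<eta> \<le> s + L" "\<forall>x\<in>{\<tau>..\<tau>+\<eta>}. m \<le> G x" using dense[OF s] by blast
    have "\<eta> * m = integral {\<tau>..\<tau>+\<eta>} (\<lambda>x. m)" using \<eta> by simp
    also have "\<dots> \<le> integral {\<tau>..\<tau>+\<eta>} G" using \<tau> by (intro integral_le int) auto
    also have "\<dots> \<le> integral {s..s+L} G" using \<tau> G0 by (intro integral_subset_le int) auto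
    finally show ?thesis .
  qed
  have "real k * L \<le> T \<Longrightarrow> integral {0..real k * L} G \<ge> real k * (\<eta> * m)" for k
  proof (induction k)
    case (Suc k)
    have k: "real k * L + L \<le> T" "0 \<le> real k * L" using Suc.prems L by (auto simp: algebra_simps)
    have "integral {0..real k * L} G + integral {real k * L..real k * L + L} G = integral {0..real k * L + L} G"
      using k L by (intro Henstock_Kurzweil_Integration.integral_combine int) auto
    moreover have "integral {0..real k * L} G \<ge> real k * (\<eta> * m)" using Suc.IH k L by auto
    moreover have "integral {real k * L..real k * L + L} G \<ge> \<eta> * m" using step k by auto
    ultimately have "real k * (\<eta> * m) + \<eta> * m \<le> integral {0..real k * L + L} G" by linarith
    moreover have "real (Suc k) * L = real k * L + L" "real (Suc k) * (\<eta> * m) = real k * (\<eta> * m) + \<eta> * m"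
      by (simp_all add: distrib_right)
    ultimately show ?case by (simp only:)
  qed simp
  note blocks = this
  define k where "k = nat \<lfloor>T / L\<rfloor>"
  have TL: "T / L \<ge> 1" using L by simp
  then have "1 \<le> \<lfloor>T / L\<rfloor>" by simp
  moreover from this have "real k = of_int \<lfloor>T / L\<rfloor>" unfolding k_def by simp
  ultimately have k': "real k \<le> T / L" "T / L \<le> 2 * real k" by linarith+
  then have k: "real k * L \<le> T" "T / (2 * L) \<le> real k" using L(1) by (simp_all add: field_simps)
  have "real k * (\<eta> * m) \<le> integral {0..real k * L} G" using blocks[OF k(1)] .
  also have "\<dots> \<le> integral {-T..T} G" using k L G0 by (intro integral_subset_le int) auto
  finally have "real k * (\<eta> * m) \<le> integral {-T..T} G" .
  moreover have "T / (2 * L) * (\<eta> * m) \<le> real k * (\<eta> * m)" using k \<eta> by (intro mult_right_mono) auto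
  ultimately show ?thesis by simp
qed

section \<open>The Bohr-Favard inequality and primitives\<close>

text \<open>
The bound of \<open>fk_mean_approx\<close> with T / (n + 1) replaced by its upper bound 2 \<pi> / \<delta>.
\<close>

definition favard_const :: "real \<Rightarrow> real" where
  "favard_const \<delta> = 1/2 + pi ^ 4 / (2 * \<delta>\<^sup>2)"

text \<open>
This is de la Vallee Poussin's argument in quantitative form. From |u(0)| \<ge> c and the almost periods at
level c/4 the mean E of |u|^2 is at least p. The autocorrelation U satisfies U(0) = E, and with the almost
periods at level p/(4C) it stays above p/2 on a set of positive density. So the mean of |U|^2, the sum
of the fourth powers of the Fourier coefficients of u, is bounded below by a number that depends neither
on T nor on the bound \<kappa> for the coefficients; it is bounded above by \<kappa>^2 E.
\<close>

lemma fk_mean_variation_bound: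
  fixes z :: "real \<Rightarrow> complex"
  assumes T: "T > 0" and n: "n \<ge> 1" and z: "continuous_on UNIV z" and C: "\<And>t. norm (z t) \<le> C"
    and coeff: "\<And>m. m \<in> {-int n..int n} \<Longrightarrow> norm (window_coeff z T m) \<le> \<kappa>"
    and u0: "c \<le> norm (fk_mean z T n 0)" and c: "c > 0"
    and per1: "2 * T \<in> almost_periods z (c/4)"
    and L1: "L1 > 0" "L1 \<le> T" and \<eta>1: "\<eta>1 > 0"
    and dense1: "\<forall>s. \<exists>\<tau>. s \<le> \<tau> \<and> \<tau> + \<eta>1 \<le> s + L1 \<and> {\<tau>..\<tau>+\<eta>1} \<subseteq> almost_periods z (c/4)"
    and p: "p = \<eta>1 * (c\<^sup>2/4) / (4 * L1)"
    and per2: "2 * T \<in> almost_periods z (p / (4 * C))"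
    and L2: "L2 > 0" "L2 \<le> T" and \<eta>2: "\<eta>2 > 0"
    and dense2: "\<forall>s. \<exists>\<tau>. s \<le> \<tau> \<and> \<tau> + \<eta>2 \<le> s + L2 \<and> {\<tau>..\<tau>+\<eta>2} \<subseteq> almost_periods z (p / (4 * C))"
  shows "\<eta>2 * (p\<^sup>2/4) / (4 * L2) \<le> \<kappa>\<^sup>2 * C\<^sup>2"
proof -
  let ?I = "{-int n..int n}"
  define u where "u = fk_mean z T n"
  define a where "a m = of_real (fk_coeff n m) * window_coeff z T m" for m
  define U where "U = trig_poly T ?I (\<lambda>m. of_real ((norm (a m))\<^sup>2))"
  have ua: "u = trig_poly T ?I a"
    unfolding u_def a_def using fk_mean_eq_trig_poly[OF z] by (simp add: fun_eq_iff)
  have cu: "continuous_on A u" for A unfolding ua by (intro continuous_intros)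
  have cU: "continuous_on A U" for A unfolding U_def by (intro continuous_intros)
  have uC: "norm (u x) \<le> C" for x unfolding u_def by (intro norm_fk_mean_le T n z C)
  have C0: "C > 0" using u0 c uC[of 0] by (simp add: u_def)
  define E where "E = (\<Sum>m\<in>?I. (norm (a m))\<^sup>2)"
  have p0: "p > 0" using p c L1 \<eta>1 by simp
  have int_u: "integral {-T..T} (\<lambda>x. (norm (u x))\<^sup>2) = 2 * T * E"
    unfolding ua E_def by (rule parseval_trig_poly[OF T]) simp
  have "integral {-T..T} (\<lambda>x. (norm (u x))\<^sup>2) \<ge> 2 * T * (\<eta>1 * (c\<^sup>2/4) / (4 * L1))"
  proof (rule integral_ge_density)
    fix s assume s: "0 \<le> s" "s + L1 \<le> T"
    obtain \<tau> where \<tau>: "s \<le> \<tau>" "\<tau> + \<eta>1 \<le> s + L1" "{\<tau>..\<tau>+\<eta>1} \<subseteq> almost_periods z (c/4)"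
      using dense1 by blast
    have "c\<^sup>2/4 \<le> (norm (u x))\<^sup>2" if x: "x \<in> {\<tau>..\<tau>+\<eta>1}" for x
    proof -
      have "norm (u (0 + x) - u 0) \<le> 2 * (c/4)"
        unfolding u_def using x \<tau> s T by (intro fk_mean_almost_period T n z per1) auto
      moreover have "c \<le> norm (u 0)" using u0 by (simp add: u_def)
      ultimately have "c/2 \<le> norm (u x)" using norm_triangle_sub[of "u 0" "u x"] by (simp add: norm_minus_commute)
      then have "(c/2)\<^sup>2 \<le> (norm (u x))\<^sup>2" using c by (intro power_mono) auto
      then show ?thesis by (simp add: power_divide)
    qed
    then show "\<exists>\<tau>. s \<le> \<tau> \<and> \<tau> + \<eta>1 \<le> s + L1 \<and> (\<forall>x\<in>{\<tau>..\<tau>+\<eta>1}. c\<^sup>2/4 \<le> (norm (u x))\<^sup>2)"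
      using \<tau> by blast
  qed (use L1 \<eta>1 in \<open>auto intro!: continuous_intros cu\<close>)
  then have Ep: "p \<le> E" unfolding int_u p[symmetric] using T by simp
  have "integral {-T..T} (\<lambda>x. (norm (u x))\<^sup>2) \<le> integral {-T..T} (\<lambda>x. C\<^sup>2)"
    using uC by (intro integral_le integrable_continuous_real continuous_intros cu power_mono) auto
  then have EC: "E \<le> C\<^sup>2" unfolding int_u using T by (simp add: mult.assoc)
  have U0: "norm (U 0) = E"
  proof -
    have "U 0 = of_real E" by (simp add: U_def trig_poly_def E_def)
    then show ?thesis using Ep p0 by simp
  qed
  have int_U: "integral {-T..T} (\<lambda>x. (norm (U x))\<^sup>2) = 2 * T * (\<Sum>m\<in>?I. ((norm (a m))\<^sup>2)\<^sup>2)"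
    unfolding U_def by (subst parseval_trig_poly[OF T]) (simp_all del: of_real_power)
  have U_diff: "norm (U x - U 0) \<le> p/2" if x: "x \<in> almost_periods z (p / (4 * C))" "0 \<le> x" "x \<le> 2 * T" for x
  proof -
    have U: "of_real (2 * T) * U y = integral {-T..T} (\<lambda>t. u (t + y) * cnj (u t))" for y
      unfolding U_def ua by (rule autocorrelation_trig_poly[symmetric, OF T]) simp
    have "norm (of_real (2 * T) * U x - of_real (2 * T) * U 0) \<le> 2 * (p / (4 * C)) * C * (T - (-T))"
      unfolding U
    proof (intro norm_integral_diff_le continuous_intros cu continuous_shift)
      fix t
      have "norm (u (t + x) * cnj (u t) - u (t + 0) * cnj (u t)) = norm (u (t + x) - u t) * norm (u t)"
        by (simp add: left_diff_distrib[symmetric] norm_mult)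
      also have "\<dots> \<le> 2 * (p / (4 * C)) * C"
        using p0 C0 x unfolding u_def
        by (intro mult_mono uC[unfolded u_def] fk_mean_almost_period T n z per2) auto
      finally show "norm (u (t + x) * cnj (u t) - u (t + 0) * cnj (u t)) \<le> 2 * (p / (4 * C)) * C" .
    qed (use T in auto)
    then have "2 * T * norm (U x - U 0) \<le> 2 * T * (p/2)"
      unfolding right_diff_distrib[symmetric] norm_mult using T C0 by (simp add: field_simps)
    then show ?thesis using T by simp
  qed
  have "integral {-T..T} (\<lambda>x. (norm (U x))\<^sup>2) \<ge> 2 * T * (\<eta>2 * (p\<^sup>2/4) / (4 * L2))"
  proof (rule integral_ge_density)
    fix s assume s: "0 \<le> s" "s + L2 \<le> T"
    obtain \<tau> where \<tau>: "s \<le> \<tau>" "\<tau> + \<eta>2 \<le> s + L2" "{\<tau>..\<tau>+\<eta>2} \<subseteq> almost_periods z (p / (4 * C))"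
      using dense2 by blast
    have "p\<^sup>2/4 \<le> (norm (U x))\<^sup>2" if x: "x \<in> {\<tau>..\<tau>+\<eta>2}" for x
    proof -
      have "norm (U x - U 0) \<le> p/2" using x \<tau> s T by (intro U_diff) auto
      then have "p/2 \<le> norm (U x)"
        using Ep U0 norm_triangle_sub[of "U 0" "U x"] by (simp add: norm_minus_commute)
      then have "(p/2)\<^sup>2 \<le> (norm (U x))\<^sup>2" using p0 by (intro power_mono) auto
      then show ?thesis by (simp add: power_divide)
    qed
    then show "\<exists>\<tau>. s \<le> \<tau> \<and> \<tau> + \<eta>2 \<le> s + L2 \<and> (\<forall>x\<in>{\<tau>..\<tau>+\<eta>2}. p\<^sup>2/4 \<le> (norm (U x))\<^sup>2)"
      using \<tau> by blast
  qed (use L2 \<eta>2 in \<open>auto intro!: continuous_intros cU\<close>)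
  then have "\<eta>2 * (p\<^sup>2/4) / (4 * L2) \<le> (\<Sum>m\<in>?I. ((norm (a m))\<^sup>2)\<^sup>2)"
    unfolding int_U using T by (simp only: mult_le_cancel_left_pos)
  also have "\<dots> \<le> (\<Sum>m\<in>?I. \<kappa>\<^sup>2 * (norm (a m))\<^sup>2)"
  proof (rule sum_mono)
    fix m assume m: "m \<in> ?I"
    have "norm (a m) = \<bar>fk_coeff n m\<bar> * norm (window_coeff z T m)" by (simp add: a_def norm_mult)
    also have "\<dots> \<le> 1 * \<kappa>" using abs_fk_coeff_le_1[OF n m] coeff[OF m] by (intro mult_mono) auto
    finally have "(norm (a m))\<^sup>2 \<le> \<kappa>\<^sup>2" by (intro power_mono) auto
    then show "((norm (a m))\<^sup>2)\<^sup>2 \<le> \<kappa>\<^sup>2 * (norm (a m))\<^sup>2"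
      unfolding power2_eq_square[of "(norm (a m))\<^sup>2"] by (intro mult_right_mono) auto
  qed
  also have "\<dots> = \<kappa>\<^sup>2 * E" by (simp add: E_def sum_distrib_left)
  also have "\<dots> \<le> \<kappa>\<^sup>2 * C\<^sup>2" using EC by (intro mult_left_mono) auto
  finally show ?thesis .
qed

text \<open>
If the inequality failed by the amount c, then the kernel average u would satisfy |u(0)| \<ge> c for all large T,
as u(0) differs from z(0) by at most B M. The levels for the almost periods, and with them the lower bound
q on the mean of |U|^2, depend on c only; the coefficients of u become so small that \<open>fk_mean_variation_bound\<close>
is violated as soon as T is large.
\<close>

lemma spectral_gap_bound_at_0:
  assumes z: "almost_periodic z" and M: "\<And>s t. norm (z s - z t) \<le> M * \<bar>s - t\<bar>"
    and gap: "spectral_gap z \<delta>" and \<delta>: "\<delta> > 0"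
  shows "norm (z 0) \<le> M * favard_const \<delta>"
proof (rule ccontr)
  assume neg: "\<not> ?thesis"
  define c where "c = norm (z 0) - M * favard_const \<delta>"
  have c: "c > 0" "c/4 > 0" using neg by (auto simp: c_def)
  have cont: "continuous_on UNIV z" using z by (rule almost_periodicD_cont)
  have M0: "M \<ge> 0" using order_trans[OF norm_ge_zero M[of 1 0]] by simp
  obtain C where C: "C > 0" "\<forall>t. norm (z t) \<le> C" using almost_periodic_bounded[OF z] by blast
  obtain L1 \<eta>1 where 1: "L1 > 0" "\<eta>1 > 0"
    "\<forall>s. \<exists>\<tau>. s \<le> \<tau> \<and> \<tau> + \<eta>1 \<le> s + L1 \<and> {\<tau>..\<tau>+\<eta>1} \<subseteq> almost_periods z (c/4)"
    using almost_periods_contain_intervals[OF z c(2)] by blast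
  define p where "p = \<eta>1 * (c\<^sup>2/4) / (4 * L1)"
  have p: "p > 0" "p / (4 * C) > 0" using c 1 C by (auto simp: p_def)
  obtain L2 \<eta>2 where 2: "L2 > 0" "\<eta>2 > 0"
    "\<forall>s. \<exists>\<tau>. s \<le> \<tau> \<and> \<tau> + \<eta>2 \<le> s + L2 \<and> {\<tau>..\<tau>+\<eta>2} \<subseteq> almost_periods z (p / (4 * C))"
    using almost_periods_contain_intervals[OF z p(2)] by blast
  define q where "q = \<eta>2 * (p\<^sup>2/4) / (4 * L2)"
  have q: "q > 0" using p 2 by (simp add: q_def)
  define \<kappa> where "\<kappa> = sqrt q / (2 * C)"
  have \<kappa>: "\<kappa> > 0" "\<kappa>\<^sup>2 * C\<^sup>2 < q" using q C by (auto simp: \<kappa>_def power_divide power_mult_distrib)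
  define d where "d = \<delta> / 2"
  have d: "d > 0" "d < \<delta>" using \<delta> by (auto simp: d_def)
  obtain T0 where T0: "T0 > 0" "\<forall>T\<ge>T0. \<forall>w. \<bar>w\<bar> \<le> d \<longrightarrow>
    norm (integral {-T..T} (\<lambda>t. z t * cis (- (w * t)))) \<le> \<kappa> * (2 * T)"
    using spectral_gap_uniform[OF cont _ gap d(2) \<kappa>(1), of C] C(2) by blast
  define e where "e = min (c/4) (p / (4 * C))"
  have e: "e > 0" using c p by (simp add: e_def)
  define T1 where "T1 = T0 + L1 + L2 + pi / d"
  obtain l where l: "\<forall>u. \<exists>\<tau>\<in>almost_periods z e. u \<le> \<tau> \<and> \<tau> \<le> u + l"
    using almost_period_in_interval[OF z e] by blast
  then obtain \<tau> where \<tau>: "\<tau> \<in> almost_periods z e" "2 * T1 \<le> \<tau>" by blast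
  \<comment> \<open>The almost period \<tau> of z becomes the circumference of the circle.\<close>
  define T where "T = \<tau> / 2"
  have "pi / d > 0" using d by simp
  then have "T1 \<ge> T0" "T1 \<ge> L1" "T1 \<ge> L2" "T1 \<ge> pi / d"
    using T0(1) 1(1) 2(1) by (auto simp: T1_def)
  moreover have "T \<ge> T1" using \<tau>(2) by (simp add: T_def)
  ultimately have T: "T > 0" "T \<ge> T0" "T \<ge> L1" "T \<ge> L2" "T \<ge> pi / d"
    using T0(1) by auto
  have per: "2 * T \<in> almost_periods z (c/4)" "2 * T \<in> almost_periods z (p / (4 * C))"
    using \<tau>(1) by (auto simp: T_def e_def intro: almost_periods_mono)
  \<comment> \<open>The largest degree for which all frequencies \<pi> m / T of the kernel lie in [-d, d].\<close>
  define n where "n = nat \<lfloor>d * T / pi\<rfloor>"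
  have "d * T / pi \<ge> 1" using T(5) d(1) by (simp add: field_simps)
  then have "1 \<le> \<lfloor>d * T / pi\<rfloor>" by simp
  moreover from this have "real n = of_int \<lfloor>d * T / pi\<rfloor>" unfolding n_def by (intro of_nat_nat) linarith
  ultimately have n: "n \<ge> 1" "real n \<le> d * T / pi" "d * T / pi \<le> real n + 1" by linarith+
  have coeff: "norm (window_coeff z T m) \<le> \<kappa>" if m: "m \<in> {-int n..int n}" for m
  proof -
    have "\<bar>of_int m\<bar> \<le> real n" using m by (auto simp: abs_le_iff)
    then have "pi / T * \<bar>of_int m\<bar> \<le> pi / T * (d * T / pi)" using n(2) T(1) by (intro mult_left_mono) auto
    also have "\<dots> = d" using T(1) by simp
    finally have "\<bar>pi / T * of_int m\<bar> \<le> d" using T(1) by (simp add: abs_mult)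
    then have "norm (integral {-T..T} (\<lambda>t. z t * cis (- (pi / T * of_int m * t)))) \<le> \<kappa> * (2 * T)"
      using T0(2) T(2) by blast
    then show ?thesis using T(1)
      by (simp add: window_coeff_def harmonic_def norm_divide norm_mult divide_le_eq)
  qed
  have "norm (fk_mean z T n 0 - z 0) \<le> M * (1/2 + T\<^sup>2 * pi\<^sup>2 / (8 * (real n + 1)\<^sup>2))"
    by (intro fk_mean_approx T n cont M)
  also have "\<dots> \<le> M * favard_const \<delta>"
  proof -
    have "T \<le> pi * (real n + 1) / d" using n(3) d(1) by (simp add: field_simps)
    then have "T\<^sup>2 \<le> (pi * (real n + 1) / d)\<^sup>2" using T(1) by (intro power_mono) auto
    then have "T\<^sup>2 * pi\<^sup>2 / (8 * (real n + 1)\<^sup>2) \<le> (pi * (real n + 1) / d)\<^sup>2 * pi\<^sup>2 / (8 * (real n + 1)\<^sup>2)"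
      by (intro divide_right_mono mult_right_mono) auto
    also have "\<dots> = pi ^ 4 / (8 * d\<^sup>2)"
    proof -
      have "(pi * k / d)\<^sup>2 * pi\<^sup>2 / (8 * k\<^sup>2) = pi ^ 4 / (8 * d\<^sup>2)" if "k \<noteq> 0" for k
        using that by (simp add: power_divide power_mult_distrib power4_eq_xxxx power2_eq_square)
      note this[of "real n + 1"]
      moreover have "real n + 1 \<noteq> 0" by linarith
      ultimately show ?thesis by blast
    qed
    also have "\<dots> = pi ^ 4 / (2 * \<delta>\<^sup>2)" by (simp add: d_def power_divide)
    finally show ?thesis unfolding favard_const_def using M0 by (intro mult_left_mono) auto
  qed
  finally have u0: "c \<le> norm (fk_mean z T n 0)"
    using norm_triangle_sub[of "z 0" "fk_mean z T n 0"] unfolding c_def by (simp add: norm_minus_commute)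
  have "q \<le> \<kappa>\<^sup>2 * C\<^sup>2"
    unfolding q_def
    by (rule fk_mean_variation_bound[OF T(1) n(1) cont _ coeff u0 c(1) per(1) 1(1) T(3) 1(2,3) p_def per(2) 2(1) T(4) 2(2,3)])
       (use C in auto)
  then show False using \<kappa>(2) by simp
qed

lemma spectral_gap_bound:
  assumes z: "almost_periodic z" and M: "\<And>s t. norm (z s - z t) \<le> M * \<bar>s - t\<bar>"
    and gap: "spectral_gap z \<delta>" and \<delta>: "\<delta> > 0"
  shows "norm (z t) \<le> M * favard_const \<delta>"
proof -
  have "norm (z (0 + t)) \<le> M * favard_const \<delta>"
  proof (rule spectral_gap_bound_at_0[of "\<lambda>s. z (s + t)"])
    show "norm (z (s + t) - z (r + t)) \<le> M * \<bar>s - r\<bar>" for s r using M[of "s + t" "r + t"] by simp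
  qed (intro almost_periodic_shift z spectral_gap_shift gap almost_periodicD_cont \<delta>)+
  then show ?thesis by simp
qed

lemma has_vector_derivative_imp_continuous_on:
  "(\<And>t. (F has_vector_derivative f t) (at t)) \<Longrightarrow> continuous_on UNIV F"
  by (meson continuous_at_imp_continuous_on has_vector_derivative_continuous)

lemma increment_lipschitz:
  fixes F f :: "real \<Rightarrow> complex"
  assumes F: "\<And>t. (F has_vector_derivative f t) (at t)" and f: "continuous_on UNIV f"
    and B: "\<And>t. norm (f t) \<le> B"
  shows "norm (F s - F t) \<le> B * \<bar>s - t\<bar>"
proof -
  have *: "norm (F b - F a) \<le> B * (b - a)" if "a \<le> b" for a b
    using norm_integral_le[OF f that, of B] B increment_eq_integral[OF F that] by simp
  show ?thesis
    using *[of s t] *[of t s] by (cases "s \<le> t") (auto simp: norm_minus_commute)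
qed

lemma has_vector_derivative_increment:
  fixes F f :: "real \<Rightarrow> complex"
  assumes F: "\<And>t. (F has_vector_derivative f t) (at t)"
  shows "((\<lambda>t. F (t + \<tau>) - F t) has_vector_derivative (f (t + \<tau>) - f t)) (at t)"
proof -
  have "((\<lambda>t. F (t + \<tau>)) has_vector_derivative f (t + \<tau>)) (at t)"
    using vector_diff_chain_at[of "\<lambda>t. t + \<tau>" 1 t F "f (t + \<tau>)"] F[of "t + \<tau>"]
    by (simp add: o_def has_vector_derivative_add_const)
  then show ?thesis by (intro has_vector_derivative_diff F)
qed

text \<open>
For an almost period \<sigma> of f the increments of F over an interval of length |\<tau>| change by at most
|\<tau>| sup |f(t + \<sigma>) - f(t)| under translation by \<sigma>. The primitive itself may still be unbounded.
\<close>

lemma almost_periodic_increment: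
  assumes f: "almost_periodic f" and F: "\<And>t. (F has_vector_derivative f t) (at t)"
  shows "almost_periodic (\<lambda>t. F (t + \<tau>) - F t)"
  unfolding almost_periodic_iff
proof (intro conjI allI impI)
  have cF: "continuous_on UNIV F" using F by (rule has_vector_derivative_imp_continuous_on)
  have cf: "continuous_on UNIV f" using f by (rule almost_periodicD_cont)
  show "continuous_on UNIV (\<lambda>t. F (t + \<tau>) - F t)"
    by (intro continuous_intros continuous_shift cF)
  fix \<epsilon> :: real assume e: "\<epsilon> > 0"
  define \<eta> where "\<eta> = \<epsilon> / (\<bar>\<tau>\<bar> + 1)"
  have \<eta>: "\<eta> > 0" "\<eta> * \<bar>\<tau>\<bar> < \<epsilon>" using e by (auto simp: \<eta>_def field_simps)
  have "almost_periods f \<eta> \<subseteq> almost_periods (\<lambda>t. F (t + \<tau>) - F t) \<epsilon>"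
  proof (intro subsetI almost_periodsI)
    fix \<sigma> t assume \<sigma>: "\<sigma> \<in> almost_periods f \<eta>"
    note d = has_vector_derivative_increment[of F f, OF F]
    have "norm ((F ((t + \<tau>) + \<sigma>) - F (t + \<tau>)) - (F (t + \<sigma>) - F t)) \<le> \<eta> * \<bar>(t + \<tau>) - t\<bar>"
      using almost_periodsD[OF \<sigma>]
      by (intro increment_lipschitz[OF d] continuous_intros continuous_shift cf) (auto intro: less_imp_le)
    then show "norm (F (t + \<sigma> + \<tau>) - F (t + \<sigma>) - (F (t + \<tau>) - F t)) < \<epsilon>"
      using \<eta>(2) by (simp add: algebra_simps)
  qed
  then show "relatively_dense (almost_periods (\<lambda>t. F (t + \<tau>) - F t) \<epsilon>)"
    using f \<eta>(1) by (auto simp: almost_periodic_iff intro: relatively_dense_mono)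
qed

text \<open>
For an almost period \<tau> of f the increment F(t + \<tau>) - F(t) has a small derivative and inherits the
spectral gap, hence is small itself by the Bohr-Favard inequality.
\<close>

theorem almost_periodic_primitive:
  assumes f: "almost_periodic f" and F: "\<And>t. (F has_vector_derivative f t) (at t)"
    and gap: "spectral_gap f \<delta>" and \<delta>: "\<delta> > 0"
  shows "almost_periodic F"
  unfolding almost_periodic_iff
proof (intro conjI allI impI)
  have cF: "continuous_on UNIV F" using F by (rule has_vector_derivative_imp_continuous_on)
  have cf: "continuous_on UNIV f" using f by (rule almost_periodicD_cont)
  show "continuous_on UNIV F" by (fact cF)
  fix \<epsilon> :: real assume e: "\<epsilon> > 0"
  have B: "favard_const \<delta> > 0" unfolding favard_const_def by (simp add: add_pos_nonneg)
  define \<eta> where "\<eta> = \<epsilon> / (2 * favard_const \<delta>)"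
  have \<eta>: "\<eta> > 0" "\<eta> * favard_const \<delta> < \<epsilon>" using e B by (auto simp: \<eta>_def)
  have nonneg: "norm (F (t + \<tau>) - F t) < \<epsilon>" if \<tau>: "\<tau> \<in> almost_periods f \<eta>" "\<tau> \<ge> 0" for \<tau> t
  proof -
    note d = has_vector_derivative_increment[of F f, OF F]
    have "norm (F (t + \<tau>) - F t) \<le> \<eta> * favard_const \<delta>"
    proof (rule spectral_gap_bound[of "\<lambda>t. F (t + \<tau>) - F t"])
      show "norm ((F (s + \<tau>) - F s) - (F (r + \<tau>) - F r)) \<le> \<eta> * \<bar>s - r\<bar>" for s r
        using almost_periodsD[OF \<tau>(1)]
        by (intro increment_lipschitz[OF d] continuous_intros continuous_shift cf) (auto intro: less_imp_le)
    qed (intro almost_periodic_increment[OF f F] spectral_gap_increment[OF cf F gap \<tau>(2)] \<delta>)+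
    then show ?thesis using \<eta>(2) by simp
  qed
  have "almost_periods f \<eta> \<subseteq> almost_periods F \<epsilon>"
  proof (intro subsetI almost_periodsI)
    fix \<tau> t assume \<tau>: "\<tau> \<in> almost_periods f \<eta>"
    show "norm (F (t + \<tau>) - F t) < \<epsilon>"
    proof (cases "\<tau> \<ge> 0")
      case False
      then show ?thesis
        using nonneg[OF almost_period_uminus[OF \<tau>], of "t + \<tau>"] by (simp add: norm_minus_commute)
    qed (use nonneg \<tau> in blast)
  qed
  then show "relatively_dense (almost_periods F \<epsilon>)"
    using f \<eta>(1) by (auto simp: almost_periodic_iff intro: relatively_dense_mono)
qed

section \<open>Oscillators with almost periodic forcing\<close>

lemma antiderivative_exists:
  fixes f :: "real \<Rightarrow> complex"
  assumes "continuous_on UNIV f"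
  shows "\<exists>F. F 0 = c \<and> (\<forall>t. (F has_vector_derivative f t) (at t))"
proof -
  have "isCont f x" for x using assms by (simp add: continuous_on_eq_continuous_at)
  then have "\<exists>F. \<forall>x :: real. - \<infinity> < ereal x \<longrightarrow> ereal x < \<infinity> \<longrightarrow> (F has_vector_derivative f x) (at x)"
    by (intro einterval_antiderivative) auto
  then obtain F where F: "\<And>x. (F has_vector_derivative f x) (at x)" by auto
  have "((\<lambda>t. F t + (c - F 0)) has_vector_derivative f x) (at x)" for x
    using F by (simp add: has_vector_derivative_add_const)
  then show ?thesis by (intro exI[of _ "\<lambda>t. F t + (c - F 0)"]) simp
qed

lemma has_vector_derivative_reflect:
  assumes "\<And>t. (F has_vector_derivative f t) (at t)"
  shows "((\<lambda>t. F (- t)) has_vector_derivative - f (- t)) (at t)"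
proof -
  have "((\<lambda>t::real. - t) has_vector_derivative -1) (at t)" by (auto intro!: derivative_eq_intros)
  then show ?thesis using vector_diff_chain_at[of uminus "-1" t F "f (- t)"] assms by (simp add: o_def)
qed

lemma has_vector_derivative_cis:
  "((\<lambda>t. cis (w * t)) has_vector_derivative \<i> * of_real w * cis (w * t)) (at t)"
  unfolding has_vector_derivative_def
  by (rule derivative_eq_intros refl | simp)+ (auto simp: fun_eq_iff scaleR_conv_of_real mult_ac)

text \<open>
Factoring y'' + w^2 y as (D - iw)(D + iw) y turns the equation into one of first order, which the factor exp(-iwt) integrates.
\<close>

lemma oscillator_first_integral:
  assumes y: "\<And>t. (y has_vector_derivative y1 t) (at t)"
    and y1: "\<And>t. (y1 has_vector_derivative h t - of_real (w\<^sup>2) * y t) (at t)"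
  shows "((\<lambda>t. cis (- w * t) * (y1 t + \<i> * of_real w * y t)) has_vector_derivative h t * cis (- w * t)) (at t)"
proof -
  have "((\<lambda>t. cis (- w * t) * (y1 t + \<i> * of_real w * y t)) has_vector_derivative
      cis (- w * t) * ((h t - of_real (w\<^sup>2) * y t) + \<i> * of_real w * y1 t)
      + \<i> * of_real (- w) * cis (- w * t) * (y1 t + \<i> * of_real w * y t)) (at t)"
    by (intro has_vector_derivative_mult has_vector_derivative_cis has_vector_derivative_add
        has_vector_derivative_mult_right y y1)
  moreover have "cis (- w * t) * ((h t - of_real (w\<^sup>2) * y t) + \<i> * of_real w * y1 t)
      + \<i> * of_real (- w) * cis (- w * t) * (y1 t + \<i> * of_real w * y t) = h t * cis (- w * t)"
    by (simp add: algebra_simps power2_eq_square)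
  ultimately show ?thesis by simp
qed

text \<open>
The first integrals for w and -w give y' + iwy and y' - iwy, whose difference is 2iwy.
\<close>

lemma oscillator_recover:
  assumes w: "w \<noteq> 0"
  shows "y t = (cis (w * t) * (cis (- w * t) * (y1 t + \<i> * of_real w * y t))
    - cis (- w * t) * (cis (- (- w) * t) * (y1 t + \<i> * of_real (- w) * y t))) / (2 * \<i> * of_real w)"
proof -
  have "cis (w * t) * cis (- w * t) = 1" by (simp add: cis_mult)
  then have "cis (w * t) * (cis (- w * t) * (y1 t + \<i> * of_real w * y t)) = y1 t + \<i> * of_real w * y t"
    "cis (- w * t) * (cis (- (- w) * t) * (y1 t + \<i> * of_real (- w) * y t)) = y1 t + \<i> * of_real (- w) * y t"
    by (simp_all add: mult.assoc[symmetric] mult.commute[of "cis (- (w * t))"])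
  then show ?thesis using w by (simp add: field_simps)
qed

lemma oscillator_almost_periodic:
  assumes y: "\<And>t. (y has_vector_derivative y1 t) (at t)"
    and y1: "\<And>t. (y1 has_vector_derivative h t - of_real (w\<^sup>2) * y t) (at t)"
    and w: "w \<noteq> 0" and h: "almost_periodic h" and \<delta>: "\<delta> > 0"
    and gap: "spectral_gap (\<lambda>t. h t * cis (- w * t)) \<delta>" "spectral_gap (\<lambda>t. h t * cis (- (- w) * t)) \<delta>"
  shows "almost_periodic y"
proof -
  define P where "P v t = cis (- v * t) * (y1 t + \<i> * of_real v * y t)" for v t
  have "almost_periodic (P v)" if v: "v = w \<or> v = - w" for v
  proof (rule almost_periodic_primitive)
    show "(P v has_vector_derivative h t * cis (- v * t)) (at t)" for t
      unfolding P_def using v y1 by (intro oscillator_first_integral y) auto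
    show "spectral_gap (\<lambda>t. h t * cis (- v * t)) \<delta>" using v gap by blast
  qed (intro almost_periodic_mult almost_periodic_cis h \<delta>)+
  then have "almost_periodic (\<lambda>t. inverse (2 * \<i> * of_real w) * (cis (w * t) * P w t - cis (- w * t) * P (- w) t))"
    by (intro almost_periodic_cmult almost_periodic_diff almost_periodic_mult almost_periodic_cis) auto
  moreover have "inverse (2 * \<i> * of_real w) * (cis (w * t) * P w t - cis (- w * t) * P (- w) t) = y t" for t
    using oscillator_recover[OF w, of y t y1] unfolding P_def by (simp only: divide_inverse mult.commute)
  ultimately show ?thesis by simp
qed

lemma oscillator_zero:
  fixes y y1 :: "real \<Rightarrow> complex"
  assumes y: "\<And>t. (y has_vector_derivative y1 t) (at t)"
    and y1: "\<And>t. (y1 has_vector_derivative - of_real (w\<^sup>2) * y t) (at t)"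
    and w: "w \<noteq> 0" and init: "y 0 = 0" "y1 0 = 0"
  shows "y t = 0"
proof -
  define P where "P v t = cis (- v * t) * (y1 t + \<i> * of_real v * y t)" for v t
  have "P v t = 0" if v: "v = w \<or> v = - w" for v
  proof -
    have "(P v has_vector_derivative 0 * cis (- v * t)) (at t)" for t
      unfolding P_def using v y1 by (intro oscillator_first_integral y) auto
    then have "(P v has_vector_derivative 0) (at t within UNIV)" for t by simp
    then obtain c where "\<And>t. P v t = c" using has_vector_derivative_zero_constant[of UNIV "P v"] by auto
    moreover have "P v 0 = 0" by (simp add: P_def init)
    ultimately show ?thesis by simp
  qed
  moreover have "y t = (cis (w * t) * P w t - cis (- w * t) * P (- w) t) / (2 * \<i> * of_real w)"
    unfolding P_def by (rule oscillator_recover[OF w])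
  ultimately show ?thesis by simp
qed

lemma oscillator_exists:
  fixes h :: "real \<Rightarrow> complex"
  assumes h: "continuous_on UNIV h" and w: "w \<noteq> 0"
  shows "\<exists>y y1. (\<forall>t. (y has_vector_derivative y1 t) (at t)) \<and>
    (\<forall>t. (y1 has_vector_derivative h t - of_real (w\<^sup>2) * y t) (at t)) \<and> y 0 = A \<and> y1 0 = B"
proof -
  let ?w = "complex_of_real w"
  have "\<exists>P. P 0 = B + \<i> * of_real w * A \<and> (\<forall>t. (P has_vector_derivative h t * cis (- w * t)) (at t))"
    "\<exists>Q. Q 0 = B - \<i> * of_real w * A \<and> (\<forall>t. (Q has_vector_derivative h t * cis (w * t)) (at t))"
    by (intro antiderivative_exists continuous_intros h)+
  then obtain P Q where P: "P 0 = B + \<i> * ?w * A" "\<And>t. (P has_vector_derivative h t * cis (- w * t)) (at t)"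
    and Q: "Q 0 = B - \<i> * ?w * A" "\<And>t. (Q has_vector_derivative h t * cis (w * t)) (at t)" by blast
  define y where "y t = inverse (2 * \<i> * ?w) * (cis (w * t) * P t - cis (- w * t) * Q t)" for t
  define y1 where "y1 t = inverse 2 * (cis (w * t) * P t + cis (- w * t) * Q t)" for t
  have cc: "cis (w * t) * cis (- w * t) = 1" for t by (simp add: cis_mult)
  have dP: "((\<lambda>t. cis (w * t) * P t) has_vector_derivative \<i> * ?w * (cis (w * t) * P t) + h t) (at t)" for t
  proof -
    have "((\<lambda>t. cis (w * t) * P t) has_vector_derivative
        cis (w * t) * (h t * cis (- w * t)) + \<i> * ?w * cis (w * t) * P t) (at t)"
      by (intro has_vector_derivative_mult has_vector_derivative_cis P)
    moreover have "cis (w * t) * (h t * cis (- w * t)) = h t"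
      by (simp only: mult.left_commute[of "cis (w * t)"] cc mult_1_right)
    then have "cis (w * t) * (h t * cis (- w * t)) + \<i> * ?w * cis (w * t) * P t = \<i> * ?w * (cis (w * t) * P t) + h t"
      by (simp only: mult.assoc add.commute)
    ultimately show ?thesis by (simp only:)
  qed
  have dQ: "((\<lambda>t. cis (- w * t) * Q t) has_vector_derivative - (\<i> * ?w * (cis (- w * t) * Q t)) + h t) (at t)" for t
  proof -
    have "((\<lambda>t. cis (- w * t) * Q t) has_vector_derivative
        cis (- w * t) * (h t * cis (w * t)) + \<i> * of_real (- w) * cis (- w * t) * Q t) (at t)"
      by (intro has_vector_derivative_mult has_vector_derivative_cis Q)
    moreover have "cis (- w * t) * (h t * cis (w * t)) = h t * (cis (w * t) * cis (- w * t))" by (simp only: mult_ac)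
    then have "cis (- w * t) * (h t * cis (w * t)) = h t" by (simp only: cc mult_1_right)
    then have "cis (- w * t) * (h t * cis (w * t)) + \<i> * of_real (- w) * cis (- w * t) * Q t
        = - (\<i> * ?w * (cis (- w * t) * Q t)) + h t"
      by (simp only:) simp
    ultimately show ?thesis by (simp only:)
  qed
  have "(y has_vector_derivative y1 t) (at t)" for t
  proof -
    have "(y has_vector_derivative inverse (2 * \<i> * ?w) *
        ((\<i> * ?w * (cis (w * t) * P t) + h t) - (- (\<i> * ?w * (cis (- w * t) * Q t)) + h t))) (at t)"
      unfolding y_def by (intro has_vector_derivative_mult_right has_vector_derivative_diff dP dQ)
    moreover have "inverse (2 * \<i> * ?w) *
        ((\<i> * ?w * (cis (w * t) * P t) + h t) - (- (\<i> * ?w * (cis (- w * t) * Q t)) + h t)) = y1 t"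
      unfolding y1_def using w by (simp add: field_simps)
    ultimately show ?thesis by simp
  qed
  moreover have "(y1 has_vector_derivative h t - of_real (w\<^sup>2) * y t) (at t)" for t
  proof -
    have "(y1 has_vector_derivative inverse 2 *
        ((\<i> * ?w * (cis (w * t) * P t) + h t) + (- (\<i> * ?w * (cis (- w * t) * Q t)) + h t))) (at t)"
      unfolding y1_def by (intro has_vector_derivative_mult_right has_vector_derivative_add dP dQ)
    moreover have "inverse 2 * ((\<i> * ?w * (cis (w * t) * P t) + h t) + (- (\<i> * ?w * (cis (- w * t) * Q t)) + h t))
        = h t - of_real (w\<^sup>2) * y t"
      unfolding y_def using w by (simp add: field_simps power2_eq_square)
    ultimately show ?thesis by (simp only:)
  qed
  moreover have "y 0 = A" "y1 0 = B" using w by (simp_all add: y_def y1_def P Q field_simps)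
  ultimately show ?thesis by blast
qed

section \<open>The equation with reflection\<close>

text \<open>
The even part for s = 1 and the odd part for s = -1. One definition with a sign treats both oscillators at once.
\<close>

definition parity_part :: "real \<Rightarrow> (real \<Rightarrow> complex) \<Rightarrow> real \<Rightarrow> complex" where
  "parity_part s f t = (f t + of_real s * f (- t)) / 2"

lemma parity_part_decomp: "f t = parity_part 1 f t + parity_part (-1) f t"
  by (simp add: parity_part_def field_simps)

lemma almost_periodic_parity_part:
  "almost_periodic f \<Longrightarrow> almost_periodic (parity_part s f)"
  using almost_periodic_cmult[OF almost_periodic_add[OF _ almost_periodic_cmult[OF almost_periodic_reflect]], of f f "1/2" "of_real s"]
  by (simp add: parity_part_def[abs_def])

text \<open>
A frequency v of exp(-i\<theta>t) times a parity part of g comes from the frequency \<theta> + v of g, or by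
reflection from -(\<theta> + v). Both are at distance |v| from \<theta> or from -\<theta>.
\<close>

lemma spectral_gap_parity_part:
  assumes g: "almost_periodic g" and freq: "\<forall>\<omega>\<in>Freq g. \<bar>\<theta> + \<omega>\<bar> \<ge> r \<and> \<bar>\<theta> - \<omega>\<bar> \<ge> r"
  shows "spectral_gap (\<lambda>t. parity_part s g t * cis (- \<theta> * t)) r"
  unfolding spectral_gap_def
proof (intro allI impI)
  fix v :: real assume v: "\<bar>v\<bar> < r"
  have cont: "continuous_on UNIV g" using g by (rule almost_periodicD_cont)
  have contr: "continuous_on UNIV (\<lambda>t. g (- t))" using almost_periodic_reflect[OF g] by (rule almost_periodicD_cont)
  have "\<theta> + v \<notin> Freq g"
  proof
    assume "\<theta> + v \<in> Freq g"
    with freq have "\<bar>\<theta> - (\<theta> + v)\<bar> \<ge> r" by blast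
    then show False using v by simp
  qed
  note 1 = not_Freq_imp_mean_zero[OF g this]
  have "- (\<theta> + v) \<notin> Freq g"
  proof
    assume "- (\<theta> + v) \<in> Freq g"
    with freq have "\<bar>\<theta> + - (\<theta> + v)\<bar> \<ge> r" by blast
    then show False using v by simp
  qed
  note 2 = mean_zero_reflect[OF not_Freq_imp_mean_zero[OF g this]]
  have "mean_zero (\<lambda>t. g t * cis (- ((\<theta> + v) * t)) + of_real s * (g (- t) * cis (- (- (\<theta> + v) * - t))))"
    by (intro mean_zero_add mean_zero_cmult 1 2 continuous_intros cont contr)
  then have "mean_zero (\<lambda>t. (1/2) * (g t * cis (- ((\<theta> + v) * t)) + of_real s * (g (- t) * cis (- (- (\<theta> + v) * - t)))))"
    by (rule mean_zero_cmult)
  moreover have "(1/2) * (g t * cis (- ((\<theta> + v) * t)) + of_real s * (g (- t) * cis (- (- (\<theta> + v) * - t))))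
      = parity_part s g t * cis (- \<theta> * t) * cis (- (v * t))" for t
  proof -
    have "cis (- \<theta> * t) * cis (- (v * t)) = cis (- ((\<theta> + v) * t))" by (simp add: cis_mult algebra_simps)
    then have e: "parity_part s g t * cis (- \<theta> * t) * cis (- (v * t)) = parity_part s g t * cis (- ((\<theta> + v) * t))"
      by (simp only: mult.assoc)
    have gen: "(1/2) * (x * c + y * (z * c)) = (x + y * z) / 2 * c" for x y z c :: complex by (simp add: field_simps)
    show ?thesis unfolding e unfolding parity_part_def gen[symmetric] minus_mult_minus ..
  qed
  ultimately show "mean_zero (\<lambda>t. parity_part s g t * cis (- \<theta> * t) * cis (- (v * t)))" by (simp only:)
qed

lemma parity_part_derivative:
  assumes "\<And>t. (x has_vector_derivative x1 t) (at t)"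
  shows "(parity_part s x has_vector_derivative parity_part (- s) x1 t) (at t)"
proof -
  have "((\<lambda>t. (x t + of_real s * x (- t)) / 2) has_vector_derivative
      (x1 t + of_real s * - x1 (- t)) / 2) (at t)"
    by (intro has_vector_derivative_divide has_vector_derivative_add has_vector_derivative_mult_right
        has_vector_derivative_reflect assms)
  then show ?thesis unfolding parity_part_def[abs_def] by simp
qed

lemma is_solutionD:
  assumes "is_solution a b g x"
  shows "(x has_vector_derivative derivative1 x t) (at t)"
    and "(derivative1 x has_vector_derivative g t - of_real a * x t - of_real b * x (- t)) (at t)"
proof -
  have x: "x differentiable (at t)" "derivative1 x differentiable (at t)"
    "derivative1 (derivative1 x) t + of_real a * x t + of_real b * x (- t) = g t" for t
    using assms unfolding is_solution_def by blast+
  show "(x has_vector_derivative derivative1 x t) (at t)"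
    using x(1) unfolding derivative1_def by (simp add: vector_derivative_works)
  have "(derivative1 x has_vector_derivative derivative1 (derivative1 x) t) (at t)"
    using x(2)[of t] unfolding derivative1_def[of "derivative1 x"] by (simp add: vector_derivative_works)
  moreover have "derivative1 (derivative1 x) t = g t - of_real a * x t - of_real b * x (- t)"
    unfolding x(3)[of t, symmetric] by simp
  ultimately show "(derivative1 x has_vector_derivative g t - of_real a * x t - of_real b * x (- t)) (at t)" by simp
qed

lemma is_solutionI:
  assumes x: "\<And>t. (x has_vector_derivative x1 t) (at t)"
    and x1: "\<And>t. (x1 has_vector_derivative g t - of_real a * x t - of_real b * x (- t)) (at t)"
  shows "is_solution a b g x" "derivative1 x = x1"
proof -
  show d: "derivative1 x = x1"
    using x by (auto simp: fun_eq_iff derivative1_def intro: vector_derivative_at)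
  have "derivative1 x1 t = g t - of_real a * x t - of_real b * x (- t)" for t
    using x1 by (auto simp: derivative1_def intro: vector_derivative_at)
  then show "is_solution a b g x"
    unfolding is_solution_def d
    using differentiableI_vector[OF x] differentiableI_vector[OF x1] by simp
qed

lemma parity_part_reflect: "s * s = 1 \<Longrightarrow> parity_part s f (- t) = of_real s * parity_part s f t"
proof -
  assume "s * s = 1"
  then have "complex_of_real s * of_real s = 1" by (metis of_real_1 of_real_mult)
  then show ?thesis by (simp add: parity_part_def field_simps)
qed

text \<open>
For x of parity s the term b x(-t) is s b x(t), so the parity parts decouple into oscillators with squared
frequencies a + b and a - b.
\<close>

lemma parity_part_equation:
  assumes x: "\<And>t. (x has_vector_derivative x1 t) (at t)"
    and x1: "\<And>t. (x1 has_vector_derivative g t - of_real a * x t - of_real b * x (- t)) (at t)"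
    and s: "s * s = 1" and w: "w\<^sup>2 = a + s * b"
  shows "(parity_part s x has_vector_derivative parity_part (- s) x1 t) (at t)"
    and "(parity_part (- s) x1 has_vector_derivative parity_part s g t - of_real (w\<^sup>2) * parity_part s x t) (at t)"
proof -
  show "(parity_part s x has_vector_derivative parity_part (- s) x1 t) (at t)"
    by (rule parity_part_derivative[OF x])
  have ss: "complex_of_real s * of_real s = 1" using s by (metis of_real_1 of_real_mult)
  have "(parity_part (- s) x1 has_vector_derivative
      parity_part (- (- s)) (\<lambda>t. g t - of_real a * x t - of_real b * x (- t)) t) (at t)"
    by (rule parity_part_derivative[OF x1])
  moreover have "parity_part (- (- s)) (\<lambda>t. g t - of_real a * x t - of_real b * x (- t)) t
      = parity_part s g t - of_real (w\<^sup>2) * parity_part s x t"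
  proof -
    have "of_real s * (of_real s * z) = z" for z :: complex using ss by (simp add: mult.assoc[symmetric])
    then show ?thesis unfolding w by (simp add: parity_part_def field_simps)
  qed
  ultimately show "(parity_part (- s) x1 has_vector_derivative parity_part s g t - of_real (w\<^sup>2) * parity_part s x t) (at t)"
    by simp
qed

text \<open>
The part of y of the wrong parity solves the homogeneous equation with zero initial values.
\<close>

lemma oscillator_parity:
  fixes y y1 h :: "real \<Rightarrow> complex"
  assumes y: "\<And>t. (y has_vector_derivative y1 t) (at t)"
    and y1: "\<And>t. (y1 has_vector_derivative h t - of_real (w\<^sup>2) * y t) (at t)"
    and w: "w \<noteq> 0" and s: "s * s = 1" and h: "\<And>t. h (- t) = of_real s * h t"
    and init: "parity_part (- s) y 0 = 0" "parity_part s y1 0 = 0"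
  shows "y (- t) = of_real s * y t"
proof -
  have ss: "complex_of_real s * of_real s = 1" using s by (metis of_real_1 of_real_mult)
  have h0: "parity_part (- s) h t = 0" for t
    using ss by (simp add: parity_part_def h mult.assoc[symmetric])
  have "parity_part (- s) y t = 0"
  proof (rule oscillator_zero[OF _ _ w])
    show "(parity_part (- s) y has_vector_derivative parity_part s y1 t) (at t)" for t
      using parity_part_derivative[OF y, of "- s"] by simp
    show "(parity_part s y1 has_vector_derivative - of_real (w\<^sup>2) * parity_part (- s) y t) (at t)" for t
    proof -
      have "parity_part (- s) (\<lambda>t. h t - of_real (w\<^sup>2) * y t) t
          = parity_part (- s) h t - of_real (w\<^sup>2) * parity_part (- s) y t"
        by (simp add: parity_part_def field_simps)
      then show ?thesis using parity_part_derivative[OF y1, of s t] by (simp add: h0)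
    qed
  qed (fact init)+
  then have "y t = of_real s * y (- t)" by (simp add: parity_part_def)
  then have "of_real s * y t = (of_real s * of_real s) * y (- t)" by (metis mult.assoc)
  then show ?thesis using ss by simp
qed

lemma oscillator_with_parity_exists:
  assumes g: "continuous_on UNIV g" and w: "w \<noteq> 0" and s: "s * s = 1"
    and A: "of_real s * A = A" and B: "of_real s * B = - B"
  shows "\<exists>y y1. (\<forall>t. (y has_vector_derivative y1 t) (at t)) \<and>
    (\<forall>t. (y1 has_vector_derivative parity_part s g t - of_real (w\<^sup>2) * y t) (at t)) \<and>
    y 0 = A \<and> y1 0 = B \<and> (\<forall>t. y (- t) = of_real s * y t)"
proof -
  have "continuous_on UNIV (\<lambda>t. g (- t))"
    by (rule continuous_on_compose2[OF g]) (auto intro: continuous_intros)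
  then have "continuous_on UNIV (parity_part s g)"
    unfolding parity_part_def[abs_def] divide_inverse by (intro continuous_intros g)
  from oscillator_exists[OF this w, of A B] obtain y y1 where
    y: "\<And>t. (y has_vector_derivative y1 t) (at t)"
    "\<And>t. (y1 has_vector_derivative parity_part s g t - of_real (w\<^sup>2) * y t) (at t)" "y 0 = A" "y1 0 = B"
    by blast
  have "y (- t) = of_real s * y t" for t
    using y(3,4) A B by (intro oscillator_parity[OF y(1,2) w s parity_part_reflect[OF s]]) (auto simp: parity_part_def)
  then show ?thesis using y by blast
qed

lemma solution_almost_periodic:
  assumes b: "- a < b" "b < a" and \<mu>: "\<mu> = sqrt (a - b)" and \<nu>: "\<nu> = sqrt (a + b)"
    and g: "almost_periodic g" and \<rho>: "\<rho> > 0" and \<sigma>: "\<sigma> > 0"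
    and f1: "\<forall>\<omega>\<in>Freq g. \<bar>\<mu> + \<omega>\<bar> \<ge> \<rho> \<and> \<bar>\<mu> - \<omega>\<bar> \<ge> \<rho>"
    and f2: "\<forall>\<omega>\<in>Freq g. \<bar>\<nu> + \<omega>\<bar> \<ge> \<sigma> \<and> \<bar>\<nu> - \<omega>\<bar> \<ge> \<sigma>"
    and x: "is_solution a b g x"
  shows "almost_periodic x"
proof -
  have part: "almost_periodic (parity_part s x)"
    if s: "s * s = 1" and w: "w\<^sup>2 = a + s * b" "w \<noteq> 0" and r: "r > 0"
      and f: "\<forall>\<omega>\<in>Freq g. \<bar>w + \<omega>\<bar> \<ge> r \<and> \<bar>w - \<omega>\<bar> \<ge> r" for s w r
  proof (rule oscillator_almost_periodic[OF parity_part_equation[OF is_solutionD[OF x] s w(1)] w(2)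
        almost_periodic_parity_part[OF g] r])
    show "spectral_gap (\<lambda>t. parity_part s g t * cis (- w * t)) r"
      by (rule spectral_gap_parity_part[OF g f])
    have "\<bar>- w + \<omega>\<bar> = \<bar>w - \<omega>\<bar>" "\<bar>- w - \<omega>\<bar> = \<bar>w + \<omega>\<bar>" for \<omega> :: real by linarith+
    then have "\<forall>\<omega>\<in>Freq g. \<bar>- w + \<omega>\<bar> \<ge> r \<and> \<bar>- w - \<omega>\<bar> \<ge> r" using f by (simp only:) blast
    then show "spectral_gap (\<lambda>t. parity_part s g t * cis (- (- w) * t)) r"
      by (rule spectral_gap_parity_part[OF g])
  qed
  have "almost_periodic (parity_part 1 x)" by (rule part[OF _ _ _ \<sigma> f2]) (use b \<nu> in auto)
  moreover have "almost_periodic (parity_part (-1) x)" by (rule part[OF _ _ _ \<rho> f1]) (use b \<mu> in auto)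
  ultimately have "almost_periodic (\<lambda>t. parity_part 1 x t + parity_part (-1) x t)" by (rule almost_periodic_add)
  then show ?thesis by (simp only: parity_part_decomp[symmetric])
qed

lemma solution_unique:
  assumes b: "- a < b" "b < a" and x: "is_solution a b g x" and y: "is_solution a b g y"
    and init: "x 0 = y 0" "derivative1 x 0 = derivative1 y 0"
  shows "x = y"
proof
  fix t
  define d where "d t = x t - y t" for t
  define d1 where "d1 t = derivative1 x t - derivative1 y t" for t
  have d: "(d has_vector_derivative d1 t) (at t)" for t
    unfolding d_def d1_def by (intro has_vector_derivative_diff is_solutionD[OF x] is_solutionD[OF y])
  have d1: "(d1 has_vector_derivative 0 - of_real a * d t - of_real b * d (- t)) (at t)" for t
  proof -
    have "(d1 has_vector_derivative (g t - of_real a * x t - of_real b * x (- t))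
        - (g t - of_real a * y t - of_real b * y (- t))) (at t)"
      unfolding d1_def by (intro has_vector_derivative_diff is_solutionD[OF x] is_solutionD[OF y])
    then show ?thesis by (simp add: d_def algebra_simps)
  qed
  have part: "parity_part s d t = 0" if s: "s * s = 1" "a + s * b > 0" for s
  proof -
    have w: "(sqrt (a + s * b))\<^sup>2 = a + s * b" "sqrt (a + s * b) \<noteq> 0" using s by auto
    note eq = parity_part_equation[OF d d1 s(1) w(1)]
    show ?thesis
    proof (rule oscillator_zero[OF eq(1) _ w(2)])
      show "(parity_part (- s) d1 has_vector_derivative - of_real ((sqrt (a + s * b))\<^sup>2) * parity_part s d t) (at t)" for t
        using eq(2)[of t] by (simp add: parity_part_def)
    qed (simp_all add: parity_part_def d_def d1_def init)
  qed
  have "d t = 0" using part[of 1] part[of "-1"] b parity_part_decomp[of d t] by simp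
  then show "x t = y t" by (simp add: d_def)
qed

text \<open>
Add the even solution p of the one oscillator with p(0) = x0 and the odd solution q of the other one
with q'(0) = v0. The parities are needed to recombine -(a + b) p - (a - b) q into -a x(t) - b x(-t).
\<close>

lemma solution_exists:
  assumes b: "- a < b" "b < a" and g: "continuous_on UNIV g"
  shows "\<exists>x. is_solution a b g x \<and> x 0 = x0 \<and> derivative1 x 0 = v0"
proof -
  have w: "sqrt (a + b) \<noteq> 0" "sqrt (a - b) \<noteq> 0" and sq: "(sqrt (a + b))\<^sup>2 = a + b" "(sqrt (a - b))\<^sup>2 = a - b"
    using b by auto
  have "of_real 1 * x0 = x0" "of_real 1 * 0 = - (0 :: complex)" "of_real (-1) * 0 = (0 :: complex)"
    "of_real (-1) * v0 = - v0" by simp_all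
  note parity = this
  have sgn11: "(-1) * (-1) = (1 :: real)" by simp
  obtain p p1 where p: "\<And>t. (p has_vector_derivative p1 t) (at t)"
    "\<And>t. (p1 has_vector_derivative parity_part 1 g t - of_real (a + b) * p t) (at t)"
    "p 0 = x0" "p1 0 = 0" "\<And>t. p (- t) = of_real 1 * p t"
    using oscillator_with_parity_exists[OF g w(1) mult_1_right parity(1,2)] unfolding sq by blast
  obtain q q1 where q: "\<And>t. (q has_vector_derivative q1 t) (at t)"
    "\<And>t. (q1 has_vector_derivative parity_part (-1) g t - of_real (a - b) * q t) (at t)"
    "q 0 = 0" "q1 0 = v0" "\<And>t. q (- t) = of_real (-1) * q t"
    using oscillator_with_parity_exists[OF g w(2) sgn11 parity(3,4)] unfolding sq by blast
  define x where "x t = p t + q t" for t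
  define x1 where "x1 t = p1 t + q1 t" for t
  have x: "(x has_vector_derivative x1 t) (at t)" for t
    unfolding x_def x1_def by (intro has_vector_derivative_add p q)
  have x1: "(x1 has_vector_derivative g t - of_real a * x t - of_real b * x (- t)) (at t)" for t
  proof -
    have "(x1 has_vector_derivative (parity_part 1 g t - of_real (a + b) * p t)
        + (parity_part (-1) g t - of_real (a - b) * q t)) (at t)"
      unfolding x1_def by (intro has_vector_derivative_add p q)
    moreover have "(parity_part 1 g t - of_real (a + b) * p t) + (parity_part (-1) g t - of_real (a - b) * q t)
        = g t - of_real a * x t - of_real b * x (- t)"
      unfolding parity_part_decomp[of g t] x_def p(5) q(5) by (simp add: algebra_simps)
    ultimately show ?thesis by simp
  qed
  have "x 0 = x0" "x1 0 = v0" by (simp_all add: x_def x1_def p(3,4) q(3,4))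
  then show ?thesis
    using is_solutionI(1)[OF x x1] is_solutionI(2)[OF x x1] by metis
qed

theorem theorem4p3:
  fixes a b \<mu> \<nu> \<rho> \<sigma> :: real and g :: "real \<Rightarrow> complex"
  assumes "b \<noteq> 0" and "- a < b" and "b < a"
    and "\<mu> = sqrt (a - b)" and "\<nu> = sqrt (a + b)"
    and "almost_periodic g"
    and "\<rho> > 0" and "\<sigma> > 0"
    and "\<forall>\<omega>\<in>Freq g. \<bar>\<mu> + \<omega>\<bar> \<ge> \<rho> \<and> \<bar>\<mu> - \<omega>\<bar> \<ge> \<rho>"
    and "\<forall>\<omega>\<in>Freq g. \<bar>\<nu> + \<omega>\<bar> \<ge> \<sigma> \<and> \<bar>\<nu> - \<omega>\<bar> \<ge> \<sigma>"
  shows "(\<forall>x. is_solution a b g x \<longrightarrow> almost_periodic x) \<and>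
    (\<forall>x0 v0. \<exists>!x. is_solution a b g x \<and> almost_periodic x \<and> x 0 = x0 \<and> derivative1 x 0 = v0)"
proof (intro conjI allI impI)
  show ap: "almost_periodic x" if "is_solution a b g x" for x
    by (rule solution_almost_periodic[OF assms(2-10) that])
  fix x0 v0
  obtain x where "is_solution a b g x" "x 0 = x0" "derivative1 x 0 = v0"
    using solution_exists[OF assms(2,3) almost_periodicD_cont[OF assms(6)]] by blast
  then show "\<exists>!x. is_solution a b g x \<and> almost_periodic x \<and> x 0 = x0 \<and> derivative1 x 0 = v0"
    using ap solution_unique[OF assms(2,3)] by (intro ex1I[of _ x]) auto
qed

end
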